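(* Let $(R,\mathfrak m,k)$ be a commutative noetherian local ring with $\mathfrak m^4=0$ and $H_R(-1)=0$. Suppose $a,b\in\mathfrak m\smallsetminus\mathfrak m^2$ form an exact pair of zero divisors. Then: (1) the initial forms $a^*,b^*$ in $\operatorname{gr}_{\mathfrak m}(R)$ form an exact pair of zero divisors in $\operatorname{gr}_{\mathfrak m}(R)$; (2) the graded rings $\operatorname{gr}_{\mathfrak m/aR}(R/aR)$ and $\operatorname{gr}_{\mathfrak m}(R)/a^*\operatorname{gr}_{\mathfrak m}(R)$ are naturally isomorphic (via the map induced by $R\to R/aR$); (3) $H_{\operatorname{gr}_{\mathfrak m}(R)/a^*\operatorname{gr}_{\mathfrak m}(R)}(t)=H_{R/aR}(t)=H_R(t)(1+t)^{-1}$.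
   Context: $H_R(t)=\sum_{n\ge0}\operatorname{rank}_k(\mathfrak m^n/\mathfrak m^{n+1})t^n$ is the Hilbert series of the local ring $R$ (for graded rings, the Hilbert series is $\sum_n \operatorname{rank}_k(\text{degree-}n\text{ part})t^n$). $\operatorname{gr}_{\mathfrak m}(R)=\bigoplus_{n\ge0}\mathfrak m^n/\mathfrak m^{n+1}$ is the associated graded ring, and $r^*$ denotes the initial form of $r\in R$. Elements $a,b$ of a ring form an exact pair of zero divisors if they are nonzero non-units with $(0:a)=bR$ and $(0:b)=aR$. *)

theory Defs
  imports "HOL-Computational_Algebra.Polynomial_FPS"
    "HOL-Algebra.Ideal_Product" "HOL-Algebra.Ring_Divisibility" "HOL-Algebra.QuotRing"
begin

fun ideal_pow :: "('a, 'b) ring_scheme \<Rightarrow> 'a set \<Rightarrow> nat \<Rightarrow> 'a set" where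
  "ideal_pow R I 0 = carrier R"
| "ideal_pow R I (Suc n) = ideal_prod R I (ideal_pow R I n)"

definition local_noetherian :: "('a, 'b) ring_scheme \<Rightarrow> 'a set \<Rightarrow> bool" where
  "local_noetherian R m \<longleftrightarrow> cring R \<and> noetherian_ring R \<and> maximalideal m R
     \<and> (\<forall>J. maximalideal J R \<longrightarrow> J = m)"

definition annihilator :: "('a, 'b) ring_scheme \<Rightarrow> 'a \<Rightarrow> 'a set" where
  "annihilator S x = {y \<in> carrier S. x \<otimes>\<^bsub>S\<^esub> y = \<zero>\<^bsub>S\<^esub>}"

definition exact_zd_pair :: "('a, 'b) ring_scheme \<Rightarrow> 'a \<Rightarrow> 'a \<Rightarrow> bool" where
  "exact_zd_pair S a b \<longleftrightarrow> a \<in> carrier S \<and> b \<in> carrier S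
     \<and> a \<noteq> \<zero>\<^bsub>S\<^esub> \<and> b \<noteq> \<zero>\<^bsub>S\<^esub> \<and> a \<notin> Units S \<and> b \<notin> Units S
     \<and> annihilator S a = PIdl\<^bsub>S\<^esub> b \<and> annihilator S b = PIdl\<^bsub>S\<^esub> a"

text \<open>An element of gr_I(R) = (+)_n I^n/I^(n+1) is a family f of cosets, f n being a coset of
  I^(n+1) inside I^n, almost all of them zero.\<close>

definition some_rep :: "'a set \<Rightarrow> 'a" where
  "some_rep X = (SOME x. x \<in> X)"

definition gr :: "('a, 'b) ring_scheme \<Rightarrow> 'a set \<Rightarrow> (nat \<Rightarrow> 'a set) ring" where
  "gr R I = \<lparr> carrier = {f. (\<forall>n. \<exists>x \<in> ideal_pow R I n. f n = ideal_pow R I (Suc n) +>\<^bsub>R\<^esub> x)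
                            \<and> finite {n. f n \<noteq> ideal_pow R I (Suc n)}},
              mult = (\<lambda>f g n. ideal_pow R I (Suc n) +>\<^bsub>R\<^esub>
                         (\<Oplus>\<^bsub>R\<^esub> i \<in> {..n}. some_rep (f i) \<otimes>\<^bsub>R\<^esub> some_rep (g (n - i)))),
              one = (\<lambda>n. if n = 0 then ideal_pow R I (Suc 0) +>\<^bsub>R\<^esub> \<one>\<^bsub>R\<^esub>
                         else ideal_pow R I (Suc n)),
              zero = (\<lambda>n. ideal_pow R I (Suc n)),
              add = (\<lambda>f g n. f n <+>\<^bsub>R\<^esub> g n) \<rparr>"

definition gr_part :: "('a, 'b) ring_scheme \<Rightarrow> 'a set \<Rightarrow> nat \<Rightarrow> (nat \<Rightarrow> 'a set) set" where
  "gr_part R I d = {f \<in> carrier (gr R I). \<forall>n. n \<noteq> d \<longrightarrow> f n = ideal_pow R I (Suc n)}"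

definition initial_form :: "('a, 'b) ring_scheme \<Rightarrow> 'a set \<Rightarrow> 'a \<Rightarrow> (nat \<Rightarrow> 'a set)" where
  "initial_form R I r = (let d = (GREATEST n. r \<in> ideal_pow R I n) in
      (\<lambda>n. if n = d then ideal_pow R I (Suc n) +>\<^bsub>R\<^esub> r else ideal_pow R I (Suc n)))"

definition gr_map :: "('a, 'b) ring_scheme \<Rightarrow> 'a set \<Rightarrow> ('c, 'd) ring_scheme \<Rightarrow> 'c set
                      \<Rightarrow> ('a \<Rightarrow> 'c) \<Rightarrow> (nat \<Rightarrow> 'a set) \<Rightarrow> (nat \<Rightarrow> 'c set)" where
  "gr_map R I S J phi f = (\<lambda>n. ideal_pow S J (Suc n) +>\<^bsub>S\<^esub> phi (some_rep (f n)))"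

text \<open>rank_k(m^n/m^(n+1)), k = R/m: the minimal size of a family in m^n whose classes span
  m^n/m^(n+1) over k (coefficients taken in R, acting through R/m).\<close>
definition local_rank :: "('a, 'b) ring_scheme \<Rightarrow> 'a set \<Rightarrow> nat \<Rightarrow> nat" where
  "local_rank R m n = (LEAST r. \<exists>xs. length xs = r \<and> set xs \<subseteq> ideal_pow R m n \<and>
      (\<forall>y \<in> ideal_pow R m n. \<exists>c \<in> {..<r} \<rightarrow> carrier R.
          y \<ominus>\<^bsub>R\<^esub> (\<Oplus>\<^bsub>R\<^esub> i \<in> {..<r}. c i \<otimes>\<^bsub>R\<^esub> xs ! i) \<in> ideal_pow R m (Suc n)))"

definition hilbert_series :: "('a, 'b) ring_scheme \<Rightarrow> 'a set \<Rightarrow> rat fps" where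
  "hilbert_series R m = Abs_fps (\<lambda>n. of_nat (local_rank R m n))"

text \<open>For a graded ring S with degree-n parts D n (D 0 = k a field), rank_k of D n:
  minimal size of a family in D n spanning D n over D 0.\<close>
definition graded_rank :: "('a, 'b) ring_scheme \<Rightarrow> (nat \<Rightarrow> 'a set) \<Rightarrow> nat \<Rightarrow> nat" where
  "graded_rank S D n = (LEAST r. \<exists>xs. length xs = r \<and> set xs \<subseteq> D n \<and>
      (\<forall>y \<in> D n. \<exists>c \<in> {..<r} \<rightarrow> D 0. y = (\<Oplus>\<^bsub>S\<^esub> i \<in> {..<r}. c i \<otimes>\<^bsub>S\<^esub> xs ! i)))"

definition graded_hilbert_series :: "('a, 'b) ring_scheme \<Rightarrow> (nat \<Rightarrow> 'a set) \<Rightarrow> rat fps" where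
  "graded_hilbert_series S D = Abs_fps (\<lambda>n. of_nat (graded_rank S D n))"

end

theory Submission
  imports Defs "HOL-Algebra.UnivPoly" "HOL-Algebra.Embedded_Algebras"
begin

text \<open>
  Write \<open>D\<^sub>n = m\<^sup>n / m\<^sup>n\<^sup>+\<^sup>1\<close>, and \<open>\<alpha>\<close>, \<open>\<beta>\<close> for the initial forms of \<open>a\<close>, \<open>b\<close>.
  Since \<open>m\<^sup>4 = 0\<close> and \<open>b \<notin> m\<^sup>2\<close>, the kernel of \<open>\<alpha>\<close> on \<open>D\<^sub>2\<close> is \<open>\<beta> D\<^sub>1\<close>, so
  \<open>dim D\<^sub>2 = dim \<alpha> D\<^sub>2 + dim \<beta> D\<^sub>1\<close>. Moreover \<open>dim \<alpha> D\<^sub>2 \<le> dim D\<^sub>3\<close> and, because \<open>\<beta>\<alpha> = 0\<close>,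
  \<open>dim \<beta> D\<^sub>1 \<le> dim D\<^sub>1 - 1\<close>. As \<open>H(-1) = 0\<close>, both inequalities are equalities; hence
  \<open>\<alpha> D\<^sub>2 = D\<^sub>3\<close>, and the kernel of \<open>\<beta>\<close> on \<open>D\<^sub>1\<close> is \<open>\<alpha> D\<^sub>0\<close>. By symmetry \<open>(\<alpha>, \<beta>)\<close> is exact.

  The rest needs only that \<open>ab = 0\<close> and that \<open>(\<alpha>, \<beta>)\<close> is exact. If the order of \<open>ay\<close> exceeds
  the sum of the orders of \<open>a\<close> and \<open>y\<close>, then subtracting a multiple of \<open>b\<close> from \<open>y\<close> raises the
  order of \<open>y\<close>; so the initial forms of \<open>aR\<close> are the multiples of \<open>\<alpha>\<close>. Exactness also gives
  \<open>dim \<alpha> D\<^sub>n + dim \<beta> D\<^sub>n\<^sub>-\<^sub>1 = dim D\<^sub>n\<close>, hence \<open>dim \<alpha> D\<^sub>n = dim \<beta> D\<^sub>n\<close> by induction, and then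
  \<open>H(t) = (1 + t) H'(t)\<close>, where \<open>H'\<close> is the series of the quotient by \<open>\<alpha>\<close>.
\<close>

subsection \<open>Dimension over a subfield\<close>

lemma (in ring) combine_eq_finsum:
  assumes "c \<in> {..<length Us} \<rightarrow> carrier R" "set Us \<subseteq> carrier R"
  shows "combine (map c [0..<length Us]) Us = (\<Oplus>i\<in>{..<length Us}. c i \<otimes> Us ! i)"
  using assms
proof (induction Us rule: rev_induct)
  case Nil
  then show ?case by simp
next
  case (snoc u Us)
  let ?n = "length Us"
  have Us: "Us ! i \<in> carrier R" if "i < ?n" for i
    using snoc.prems(2) that by auto
  have "(\<Oplus>i\<in>{..<Suc ?n}. c i \<otimes> (Us @ [u]) ! i) =
      c ?n \<otimes> u \<oplus> (\<Oplus>i\<in>{..<?n}. c i \<otimes> (Us @ [u]) ! i)"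
    using snoc.prems Us by (subst lessThan_Suc, subst finsum_insert) (auto simp: nth_append Pi_iff)
  also have "(\<Oplus>i\<in>{..<?n}. c i \<otimes> (Us @ [u]) ! i) = combine (map c [0..<?n]) Us"
    using snoc Us by (subst snoc.IH) (auto simp: nth_append Pi_iff intro!: finsum_cong')
  also have "c ?n \<otimes> u \<oplus> combine (map c [0..<?n]) Us =
      combine (map c [0..<?n]) Us \<oplus> combine [c ?n] [u]"
    using snoc.prems a_comm combine_in_carrier[of "map c [0..<?n]" Us]
    by (simp add: image_subset_iff Pi_iff)
  also have "\<dots> = combine (map c [0..<?n] @ [c ?n]) (Us @ [u])"
    using snoc.prems by (intro combine_append) auto
  finally show ?case by simp
qed

lemma (in ring) Span_iff_finsum:
  assumes K: "subfield K R" and Us: "set Us \<subseteq> carrier R"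
  shows "y \<in> Span K Us \<longleftrightarrow>
    (\<exists>c \<in> {..<length Us} \<rightarrow> K. y = (\<Oplus>i\<in>{..<length Us}. c i \<otimes> Us ! i))"
proof -
  have combine: "combine (map c [0..<length Us]) Us = (\<Oplus>i\<in>{..<length Us}. c i \<otimes> Us ! i)"
    if "c \<in> {..<length Us} \<rightarrow> K" for c
    using that subfieldE(3)[OF K] Us by (intro combine_eq_finsum) auto
  show ?thesis
    unfolding Span_mem_iff_length_version[OF K Us]
  proof safe
    fix Ks assume Ks: "set Ks \<subseteq> K" "length Ks = length Us"
    then have Ks_in: "(!) Ks \<in> {..<length Us} \<rightarrow> K" by auto
    have "map ((!) Ks) [0..<length Us] = Ks"
      using map_nth[of Ks] Ks(2) by simp
    then have "combine Ks Us = (\<Oplus>i\<in>{..<length Us}. Ks ! i \<otimes> Us ! i)"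
      using combine[OF Ks_in] by simp
    with Ks_in show "\<exists>c\<in>{..<length Us} \<rightarrow> K. combine Ks Us = (\<Oplus>i\<in>{..<length Us}. c i \<otimes> Us ! i)"
      by blast
  next
    fix c assume c: "c \<in> {..<length Us} \<rightarrow> K"
    then show "\<exists>Ks. set Ks \<subseteq> K \<and> length Ks = length Us \<and>
        (\<Oplus>i\<in>{..<length Us}. c i \<otimes> Us ! i) = combine Ks Us"
      using combine[OF c] by (intro exI[of _ "map c [0..<length Us]"]) auto
  qed
qed

lemma (in ring) dim_Span_le_length:
  assumes K: "subfield K R" and "set Us \<subseteq> carrier R"
  shows "(dim over K) (Span K Us) \<le> length Us"
  using assms(2)
proof (induction Us)
  case Nil
  then show ?case
    using dimI[OF K zero_dim] by simp
next
  case (Cons u Us)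
  then have u: "u \<in> carrier R" and Us: "set Us \<subseteq> carrier R" by auto
  show ?case
  proof (cases "u \<in> Span K Us")
    case True
    then have "set (u # Us) \<subseteq> Span K Us"
      using Span_base_incl[OF K Us] by (auto simp del: Span.simps)
    then have "Span K (u # Us) = Span K Us"
      using mono_Span_subset[OF K _ Us, of "u # Us"] mono_Span[OF K Us u]
      by (intro equalityI) (auto simp del: Span.simps)
    then show ?thesis
      using Cons.IH[OF Us] by (simp del: Span.simps)
  next
    case False
    have "dimension ((dim over K) (Span K Us)) K (Span K Us)"
      by (rule finite_dimensionE[OF K Span_finite_dimension[OF K Us]])
    from dimI[OF K Suc_dim[OF u False this]]
    show ?thesis
      using Cons.IH[OF Us] by simp
  qed
qed

lemma (in ring)
  assumes K: "subfield K R" and E: "finite_dimension K E" and F: "finite_dimension K F"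
    and "E \<subseteq> F"
  shows dim_mono: "(dim over K) E \<le> (dim over K) F"
    and dim_eq_imp_eq: "(dim over K) E = (dim over K) F \<Longrightarrow> E = F"
proof -
  obtain Us where Us: "independent K Us" "length Us = (dim over K) E" "Span K Us = E"
    using exists_base[OF K finite_dimensionE[OF K E]] by blast
  moreover have "set Us \<subseteq> F"
    using Us Span_base_incl[OF K independent_in_carrier[OF Us(1)]] \<open>E \<subseteq> F\<close> by blast
  ultimately show "(dim over K) E \<le> (dim over K) F" "(dim over K) E = (dim over K) F \<Longrightarrow> E = F"
    using independent_length_le_dimension[OF K finite_dimensionE[OF K F]]
      independent_length_eq_dimension[OF K finite_dimensionE[OF K F]] by metis+
qed

lemma (in ring) dim_zero_space: "subfield K R \<Longrightarrow> (dim over K) {\<zero>} = 0"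
  by (rule dimI[OF _ zero_dim])

lemma (in cring) mult_image_line_extension:
  assumes "K \<subseteq> carrier R" "E \<subseteq> carrier R" "c \<in> carrier R" "v \<in> carrier R"
  shows "(\<otimes>) c ` line_extension K v E = line_extension K (c \<otimes> v) ((\<otimes>) c ` E)"
proof -
  have mult: "c \<otimes> (k \<otimes> v \<oplus> e) = k \<otimes> (c \<otimes> v) \<oplus> c \<otimes> e" if "k \<in> K" "e \<in> E" for k e
    using that assms by (simp add: subset_iff r_distr m_lcomm)
  have line: "line_extension K u F = (\<Union>k\<in>K. (\<lambda>e. k \<otimes> u \<oplus> e) ` F)" for u F
    by (auto simp only: set_eq_iff line_extension_mem_iff UN_iff image_iff)
  show ?thesis
    unfolding line image_UN image_image using mult by simp
qed

lemma (in cring) dimension_mult_image_line_extension: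
  assumes K: "subfield K R" and F: "subalgebra K F R" and c: "c \<in> carrier R"
    and w: "w \<in> carrier R" "w \<notin> F" and dim: "dimension n K ((\<otimes>) c ` F)"
    and kernel: "\<And>x. \<lbrakk>x \<in> line_extension K w F; c \<otimes> x = \<zero>\<rbrakk> \<Longrightarrow> x \<in> F"
  shows "dimension (Suc n) K ((\<otimes>) c ` line_extension K w F)"
proof -
  interpret F: subalgebra K F R by (rule F)
  have "c \<otimes> w \<notin> (\<otimes>) c ` F"
  proof
    assume "c \<otimes> w \<in> (\<otimes>) c ` F"
    then obtain f where f: "f \<in> F" "c \<otimes> w = c \<otimes> f" by blast
    have f_carr: "f \<in> carrier R"
      using f(1) subalgebra_in_carrier[OF F] by blast
    have "w \<ominus> f = \<one> \<otimes> w \<oplus> \<ominus> f"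
      using w(1) by (simp add: a_minus_def)
    then have "w \<ominus> f \<in> line_extension K w F"
      using subringE(3)[OF subfieldE(1)[OF K]] F.m_inv_closed[OF f(1)]
      unfolding line_extension_mem_iff a_inv_def by blast
    moreover have "c \<otimes> (w \<ominus> f) = \<zero>"
      using f(2) f_carr w(1) c by (simp add: a_minus_def r_distr r_minus r_neg)
    ultimately have "(w \<ominus> f) \<oplus> f \<in> F"
      using F.m_closed[OF kernel f(1)] by simp
    then show False
      using w f_carr by (simp add: a_minus_def a_assoc l_neg)
  qed
  then show ?thesis
    using Suc_dim[OF _ _ dim] c w(1) subalgebra_in_carrier[OF F] subfieldE(3)[OF K]
    by (simp add: mult_image_line_extension)
qed

lemma (in cring) dimension_mult_image_append:
  assumes K: "subfield K R" and c: "c \<in> carrier R" and "independent K (Ws @ Us)"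
    and "\<And>x. x \<in> Span K (Ws @ Us) \<Longrightarrow> c \<otimes> x = \<zero> \<longleftrightarrow> x \<in> Span K Us"
  shows "dimension (length Ws) K ((\<otimes>) c ` Span K (Ws @ Us))"
  using assms(3-)
proof (induction Ws)
  case Nil
  have "set Us \<subseteq> carrier R"
    using independent_in_carrier[OF Nil.prems(1)] by simp
  then have "\<zero> \<in> Span K Us"
    by (rule Span_subgroup_props(2)[OF K])
  then have "(\<otimes>) c ` Span K Us = {\<zero>}"
    using Nil.prems(2) by (auto simp del: Span.simps)
  then show ?case
    by (simp del: Span.simps)
next
  case (Cons w Ws)
  let ?F = "Span K (Ws @ Us)"
  have w: "w \<in> carrier R" "w \<notin> ?F" and ind: "independent K (Ws @ Us)"
    using Cons.prems(1) by (auto elim: independent.cases)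
  have carr: "set (Ws @ Us) \<subseteq> carrier R"
    by (rule independent_in_carrier[OF ind])
  have E: "Span K ((w # Ws) @ Us) = line_extension K w ?F"
    by simp
  have "?F \<subseteq> Span K ((w # Ws) @ Us)"
    using mono_Span[OF K carr w(1)] by simp
  then have "dimension (length Ws) K ((\<otimes>) c ` ?F)"
    using Cons.IH[OF ind] Cons.prems(2) by blast
  moreover have "x \<in> ?F" if "x \<in> line_extension K w ?F" "c \<otimes> x = \<zero>" for x
    using that Cons.prems(2)[of x] mono_Span_sublist[OF K _ carr, of Us] unfolding E by auto
  ultimately show ?case
    unfolding E using dimension_mult_image_line_extension[OF K Span_is_subalgebra[OF K carr] c w]
    by (simp del: Span.simps)
qed

lemma (in cring) dimension_mult_image:
  assumes K: "subfield K R" and c: "c \<in> carrier R"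
    and E: "dimension n K E" and N: "dimension k K {x \<in> E. c \<otimes> x = \<zero>}"
  shows "dimension (n - k) K ((\<otimes>) c ` E)"
proof -
  let ?N = "{x \<in> E. c \<otimes> x = \<zero>}"
  obtain Us where Us: "set Us \<subseteq> carrier R" "independent K Us" "length Us = k" "Span K Us = ?N"
    using exists_base[OF K N] by blast
  then have "set Us \<subseteq> E"
    using Span_base_incl[OF K Us(1)] by blast
  then obtain Vs where Vs: "length (Vs @ Us) = n" "independent K (Vs @ Us)" "Span K (Vs @ Us) = E"
    using complete_base[OF K E Us(2)] by blast
  then have "dimension (length Vs) K ((\<otimes>) c ` E)"
    using dimension_mult_image_append[OF K c Vs(2)] Us(4) by blast
  then show ?thesis
    using Vs(1) Us(3) by auto
qed

lemma (in cring)
  assumes K: "subfield K R" and c: "c \<in> carrier R" and E: "finite_dimension K E"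
  shows finite_dimension_mult_image: "finite_dimension K ((\<otimes>) c ` E)"
    and finite_dimension_mult_kernel: "finite_dimension K {x \<in> E. c \<otimes> x = \<zero>}"
    and dim_mult_image:
      "(dim over K) ((\<otimes>) c ` E) + (dim over K) {x \<in> E. c \<otimes> x = \<zero>} = (dim over K) E"
proof -
  let ?N = "{x \<in> E. c \<otimes> x = \<zero>}"
  have sub: "subalgebra K E R"
    by (rule finite_dimension_imp_subalgebra[OF K E])
  note E_carrier = subalgebra_in_carrier[OF sub] and K_carrier = subfieldE(3)[OF K]
  note E_closed = space_subgroup_props[OF K finite_dimensionE[OF K E]]
  have "subalgebra K ?N R"
  proof (intro subalgebra.intro subalgebra_axioms.intro add.subgroupI)
    show "?N \<noteq> {}"
      using E_closed(2) c by auto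
    show "k \<otimes> v \<in> ?N" if "k \<in> K" "v \<in> ?N" for k v
      using that E_carrier K_carrier c E_closed(5) m_lcomm[of c k v] by (auto simp: subset_iff)
  qed (use E_carrier E_closed c in \<open>auto simp: r_distr r_minus subset_iff\<close>)
  then show N: "finite_dimension K ?N"
    by (rule subalbegra_incl_imp_finite_dimension[OF K E]) blast
  have image: "dimension ((dim over K) E - (dim over K) ?N) K ((\<otimes>) c ` E)"
    by (rule dimension_mult_image[OF K c finite_dimensionE[OF K E] finite_dimensionE[OF K N]])
  then show "finite_dimension K ((\<otimes>) c ` E)"
    by (rule finite_dimensionI)
  show "(dim over K) ((\<otimes>) c ` E) + (dim over K) ?N = (dim over K) E"
    using dimI[OF K image] dim_mono[OF K N E] by simp
qed

lemma (in ring_hom_ring)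
  assumes K: "subfield K R" and nontrivial: "\<one>\<^bsub>S\<^esub> \<noteq> \<zero>\<^bsub>S\<^esub>" and E: "R.finite_dimension K E"
  shows finite_dimension_image: "S.finite_dimension (h ` K) (h ` E)"
    and dim_image: "(S.dim over h ` K) (h ` E) + (R.dim over K) {x \<in> E. h x = \<zero>\<^bsub>S\<^esub>} =
      (R.dim over K) E"
proof -
  let ?N = "{x \<in> E. h x = \<zero>\<^bsub>S\<^esub>}"
  have sub: "subalgebra K E R"
    by (rule R.finite_dimension_imp_subalgebra[OF K E])
  have "?N = E \<inter> a_kernel R S h"
    unfolding a_kernel_def' using R.subalgebra_in_carrier[OF sub] by blast
  then have "subalgebra K ?N R"
    using R.subalgebra_inter[OF sub R.ideal_is_subalgebra[OF subfieldE(3)[OF K] kernel_is_ideal]]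
    by simp
  then have N: "R.finite_dimension K ?N"
    by (rule R.subalbegra_incl_imp_finite_dimension[OF K E]) blast
  have "a_kernel (R\<lparr>carrier := E\<rparr>) S h = ?N"
    unfolding a_kernel_def' by simp
  then have image: "S.dimension ((R.dim over K) E - (R.dim over K) ?N) (h ` K) (h ` E)"
    using rank_nullity_theorem[OF K nontrivial] R.finite_dimensionE[OF K] E N by metis
  then show "S.finite_dimension (h ` K) (h ` E)"
    by (rule S.finite_dimensionI)
  show "(S.dim over h ` K) (h ` E) + (R.dim over K) ?N = (R.dim over K) E"
    using S.dimI[OF img_is_subfield(2)[OF K nontrivial] image] R.dim_mono[OF K N E] by simp
qed

lemma (in ring) graded_rank_eq_dim:
  assumes K: "subfield (D 0) R" and Dn: "finite_dimension (D 0) (D n)"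
  shows "graded_rank R D n = (dim over D 0) (D n)"
proof -
  have sub: "subalgebra (D 0) (D n) R"
    by (rule finite_dimension_imp_subalgebra[OF K Dn])
  have spanning: "(\<forall>y\<in>D n. \<exists>c\<in>{..<r} \<rightarrow> D 0. y = (\<Oplus>i\<in>{..<r}. c i \<otimes> xs ! i)) \<longleftrightarrow>
      D n \<subseteq> Span (D 0) xs" if "set xs \<subseteq> D n" "length xs = r" for xs r
    using that subalgebra_in_carrier[OF sub] Span_iff_finsum[OF K, of xs] by blast
  show ?thesis
    unfolding graded_rank_def
  proof (rule Least_equality)
    obtain Us where "length Us = (dim over D 0) (D n)" "Span (D 0) Us = D n" "set Us \<subseteq> carrier R"
      using exists_base[OF K finite_dimensionE[OF K Dn]] by blast
    moreover from this have "set Us \<subseteq> D n"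
      using Span_base_incl[OF K] by blast
    ultimately show "\<exists>xs. length xs = (dim over D 0) (D n) \<and> set xs \<subseteq> D n \<and>
        (\<forall>y\<in>D n. \<exists>c\<in>{..<(dim over D 0) (D n)} \<rightarrow> D 0.
          y = (\<Oplus>i\<in>{..<(dim over D 0) (D n)}. c i \<otimes> xs ! i))"
      using spanning by blast
  next
    fix r
    assume "\<exists>xs. length xs = r \<and> set xs \<subseteq> D n \<and>
        (\<forall>y\<in>D n. \<exists>c\<in>{..<r} \<rightarrow> D 0. y = (\<Oplus>i\<in>{..<r}. c i \<otimes> xs ! i))"
    then obtain xs where xs: "length xs = r" "set xs \<subseteq> D n" "D n \<subseteq> Span (D 0) xs"
      using spanning by blast
    have carr: "set xs \<subseteq> carrier R"
      using xs(2) subalgebra_in_carrier[OF sub] by blast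
    have "(dim over D 0) (D n) \<le> (dim over D 0) (Span (D 0) xs)"
      by (rule dim_mono[OF K Dn Span_finite_dimension[OF K carr] xs(3)])
    also have "\<dots> \<le> r"
      using dim_Span_le_length[OF K carr] xs(1) by simp
    finally show "(dim over D 0) (D n) \<le> r" .
  qed
qed

subsection \<open>Graded rings\<close>

lemma (in cring) annihilator_eq_PIdlD:
  assumes "annihilator R x = PIdl y" "y \<in> carrier R"
  shows "x \<otimes> y = \<zero>"
  using assms cgenideal_self[OF assms(2)] by (auto simp: annihilator_def)

lemma (in cring) ideal_annihilator:
  assumes "x \<in> carrier R"
  shows "ideal (annihilator R x) R"
proof (rule idealI[OF ring_axioms])
  show "subgroup (annihilator R x) (add_monoid R)"
    by (rule add.subgroupI) (use assms in \<open>auto simp: annihilator_def r_distr r_minus\<close>)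
  show yz: "z \<otimes> y \<in> annihilator R x" if "y \<in> annihilator R x" "z \<in> carrier R" for y z
    using that assms by (simp add: annihilator_def m_lcomm[of x])
  show "y \<otimes> z \<in> annihilator R x" if "y \<in> annihilator R x" "z \<in> carrier R" for y z
    using yz[OF that] that m_comm[of y z] by (simp add: annihilator_def)
qed

lemma (in cring) exact_zd_pairI:
  assumes x: "x \<in> carrier R" "x \<noteq> \<zero>" "annihilator R x = PIdl y"
    and y: "y \<in> carrier R" "y \<noteq> \<zero>" "annihilator R y = PIdl x"
  shows "exact_zd_pair R x y"
proof -
  have xy: "x \<otimes> y = \<zero>"
    by (rule annihilator_eq_PIdlD[OF x(3) y(1)])
  have not_unit: "u \<notin> Units R" if "u \<in> carrier R" "v \<in> carrier R" "v \<noteq> \<zero>" "u \<otimes> v = \<zero>" for u v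
  proof
    assume u: "u \<in> Units R"
    have "v = inv u \<otimes> (u \<otimes> v)"
      using u that(1,2) Units_inv_closed[OF u] by (simp add: m_assoc[symmetric])
    then show False
      using that(3,4) u by simp
  qed
  show ?thesis
    unfolding exact_zd_pair_def
    using x y xy not_unit[of x y] not_unit[of y x] m_comm[of y x] by simp
qed

lemma (in cring) one_notin_PIdl:
  assumes "x \<in> carrier R" "x \<notin> Units R"
  shows "\<one> \<notin> PIdl x"
proof
  assume "\<one> \<in> PIdl x"
  then obtain y where y: "y \<in> carrier R" "y \<otimes> x = \<one>"
    by (auto simp: cgenideal_def)
  then have "x \<otimes> y = \<one>"
    using m_comm[OF assms(1) y(1)] by simp
  with y have "x \<in> Units R"
    using assms(1) by (auto simp: Units_def)
  with assms(2) show False ..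
qed

lemma (in cring) a_kernel_quotient_PIdl:
  assumes "a \<in> carrier R"
  shows "a_kernel R (R Quot (PIdl a)) ((+>) (PIdl a)) = PIdl a"
proof -
  interpret A: ideal "PIdl a" R by (rule cgenideal_ideal[OF assms])
  have "PIdl a +> x = PIdl a \<longleftrightarrow> x \<in> PIdl a" if "x \<in> carrier R" for x
    using that A.rcos_const_imp_mem a_rcos_zero[OF A.is_ideal] by blast
  moreover have "\<zero>\<^bsub>R Quot (PIdl a)\<^esub> = PIdl a"
    by (simp add: FactRing_def)
  ultimately show ?thesis
    unfolding a_kernel_def' using A.a_subset by auto
qed

text \<open>A direct sum decomposition is encoded by its projections \<open>component n\<close>.\<close>

locale graded_cring = cring R for R (structure) +
  fixes D :: "nat \<Rightarrow> 'a set" and component :: "nat \<Rightarrow> 'a \<Rightarrow> 'a"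
  assumes part_subgroup: "additive_subgroup (D n) R"
    and part_mult: "\<lbrakk>f \<in> D i; g \<in> D j\<rbrakk> \<Longrightarrow> f \<otimes> g \<in> D (i + j)"
    and component_in_part: "f \<in> carrier R \<Longrightarrow> component n f \<in> D n"
    and component_add: "\<lbrakk>f \<in> carrier R; g \<in> carrier R\<rbrakk> \<Longrightarrow>
      component n (f \<oplus> g) = component n f \<oplus> component n g"
    and component_homogeneous: "f \<in> D k \<Longrightarrow> component n f = (if n = k then f else \<zero>)"
    and finsum_components: "f \<in> carrier R \<Longrightarrow> \<exists>A. finite A \<and> f = (\<Oplus>n\<in>A. component n f)"
begin

lemma part_carrier: "f \<in> D n \<Longrightarrow> f \<in> carrier R"
  using additive_subgroup.a_subset[OF part_subgroup] by blast

lemma zero_in_part: "\<zero> \<in> D n"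
  by (rule additive_subgroup.zero_closed[OF part_subgroup])

lemma subalgebra_part: "subalgebra (D 0) (D n) R"
  using additive_subgroup.a_subgroup[OF part_subgroup] part_mult[of _ 0]
  by (intro subalgebra.intro subalgebra_axioms.intro) auto

lemma component_zero: "component n \<zero> = \<zero>"
  using component_homogeneous[OF zero_in_part] by simp

lemma component_induct [consumes 1, case_names zero component add]:
  assumes f: "f \<in> carrier R"
    and zero: "P \<zero>"
    and component: "\<And>n. P (component n f)"
    and add: "\<And>x y. \<lbrakk>x \<in> carrier R; y \<in> carrier R; P x; P y\<rbrakk> \<Longrightarrow> P (x \<oplus> y)"
  shows "P f"
proof -
  obtain A where A: "finite A" "f = (\<Oplus>n\<in>A. component n f)"
    using finsum_components[OF f] by blast
  have "P (\<Oplus>n\<in>A. component n f)"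
    using A(1)
  proof (induction A)
    case empty
    then show ?case
      using zero by simp
  next
    case (insert n A)
    have "component i f \<in> carrier R" for i
      using component_in_part[OF f] part_carrier by blast
    then show ?case
      using insert component by (simp add: add)
  qed
  with A(2) show ?thesis by simp
qed

lemma mem_ideal_if_components_mem:
  assumes J: "ideal J R" and f: "f \<in> carrier R" and "\<And>n. component n f \<in> J"
  shows "f \<in> J"
proof -
  interpret J: ideal J R by (rule J)
  show ?thesis
    using f by (induction f rule: component_induct) (simp_all add: assms(3))
qed

lemma component_mult_homogeneous:
  assumes f: "f \<in> carrier R" and \<alpha>: "\<alpha> \<in> D d"
  shows "component n (\<alpha> \<otimes> f) = (if n < d then \<zero> else \<alpha> \<otimes> component (n - d) f)"
  using f
proof (induction f rule: component_induct)
  case zero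
  then show ?case
    using part_carrier[OF \<alpha>] by (simp add: component_zero)
next
  case (component k)
  have f_k: "component k f \<in> D k"
    by (rule component_in_part[OF f])
  have "component n (\<alpha> \<otimes> component k f) = (if n = d + k then \<alpha> \<otimes> component k f else \<zero>)"
    by (rule component_homogeneous[OF part_mult[OF \<alpha> f_k]])
  then show ?case
    using component_homogeneous[OF f_k, of "n - d"] part_carrier[OF \<alpha>] by auto
next
  case (add x y)
  then show ?case
    using part_carrier[OF \<alpha>] part_carrier[OF component_in_part]
    by (simp add: r_distr component_add)
qed

lemma component_mult_homogeneous_eq_zero:
  assumes "f \<in> carrier R" "\<alpha> \<in> D d" "\<alpha> \<otimes> f = \<zero>"
  shows "\<alpha> \<otimes> component n f = \<zero>"
  using component_mult_homogeneous[OF assms(1,2), of "n + d"] assms(3) by (simp add: component_zero)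

lemma PIdl_Int_part:
  assumes \<alpha>: "\<alpha> \<in> D d"
  shows "PIdl \<alpha> \<inter> D n = (if n < d then {\<zero>} else (\<otimes>) \<alpha> ` D (n - d))"
proof (intro equalityI subsetI)
  fix f assume f: "f \<in> PIdl \<alpha> \<inter> D n"
  then obtain g where g: "g \<in> carrier R" "f = \<alpha> \<otimes> g"
    using m_comm[OF part_carrier[OF \<alpha>]] by (auto simp: cgenideal_def)
  have "f = component n f"
    using f component_homogeneous[of f n n] by simp
  also have "\<dots> = (if n < d then \<zero> else \<alpha> \<otimes> component (n - d) g)"
    unfolding g(2) by (rule component_mult_homogeneous[OF g(1) \<alpha>])
  finally show "f \<in> (if n < d then {\<zero>} else (\<otimes>) \<alpha> ` D (n - d))"
    using component_in_part[OF g(1), of "n - d"] by simp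
next
  fix f assume f: "f \<in> (if n < d then {\<zero>} else (\<otimes>) \<alpha> ` D (n - d))"
  show "f \<in> PIdl \<alpha> \<inter> D n"
  proof (cases "n < d")
    case True
    then show ?thesis
      using f zero_in_part additive_subgroup.zero_closed[OF ideal.axioms(1)]
        cgenideal_ideal[OF part_carrier[OF \<alpha>]] by auto
  next
    case False
    then obtain g where g: "g \<in> D (n - d)" "f = \<alpha> \<otimes> g"
      using f by auto
    moreover have "f \<in> D n"
      using part_mult[OF \<alpha> g(1)] g(2) False by simp
    ultimately show ?thesis
      using m_comm[OF part_carrier[OF \<alpha>] part_carrier] part_carrier by (auto simp: cgenideal_def)
  qed
qed

lemma annihilator_eq_PIdlI:
  assumes \<alpha>: "\<alpha> \<in> D d" and \<beta>: "\<beta> \<in> carrier R" "\<alpha> \<otimes> \<beta> = \<zero>"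
    and kernel: "\<And>n f. \<lbrakk>f \<in> D n; \<alpha> \<otimes> f = \<zero>\<rbrakk> \<Longrightarrow> f \<in> PIdl \<beta>"
  shows "annihilator R \<alpha> = PIdl \<beta>"
proof
  note \<alpha>_carrier = part_carrier[OF \<alpha>]
  show "PIdl \<beta> \<subseteq> annihilator R \<alpha>"
    using cgenideal_minimal[OF ideal_annihilator[OF \<alpha>_carrier]] \<beta> by (simp add: annihilator_def)
  show "annihilator R \<alpha> \<subseteq> PIdl \<beta>"
  proof
    fix f assume "f \<in> annihilator R \<alpha>"
    then have f: "f \<in> carrier R" "\<alpha> \<otimes> f = \<zero>"
      by (auto simp: annihilator_def)
    show "f \<in> PIdl \<beta>"
    proof (rule mem_ideal_if_components_mem[OF cgenideal_ideal[OF \<beta>(1)] f(1)])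
      show "component n f \<in> PIdl \<beta>" for n
        using kernel[OF component_in_part[OF f(1)]]
          component_mult_homogeneous_eq_zero[OF f(1) \<alpha> f(2)] .
    qed
  qed
qed

lemma kernel_mult_part:
  assumes "annihilator R \<alpha> = PIdl \<beta>" "\<beta> \<in> D d"
  shows "{f \<in> D n. \<alpha> \<otimes> f = \<zero>} = (if n < d then {\<zero>} else (\<otimes>) \<beta> ` D (n - d))"
proof -
  have "{f \<in> D n. \<alpha> \<otimes> f = \<zero>} = annihilator R \<alpha> \<inter> D n"
    using part_carrier by (auto simp: annihilator_def)
  also have "\<dots> = PIdl \<beta> \<inter> D n"
    by (simp only: assms(1))
  also have "\<dots> = (if n < d then {\<zero>} else (\<otimes>) \<beta> ` D (n - d))"
    by (rule PIdl_Int_part[OF assms(2)])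
  finally show ?thesis .
qed

end

subsection \<open>Exact pairs in graded algebras over a field\<close>

locale graded_algebra = graded_cring +
  assumes subfield_part: "subfield (D 0) R"
    and finite_dimension_part: "finite_dimension (D 0) (D n)"
begin

abbreviation dim0 :: "'a set \<Rightarrow> nat" where "dim0 \<equiv> dim over D 0"

lemma graded_rank_eq: "graded_rank R D n = dim0 (D n)"
  using graded_rank_eq_dim[where D = D] subfield_part finite_dimension_part .

lemmas dim_mult_image_part =
  dim_mult_image[OF subfield_part part_carrier finite_dimension_part]

lemmas finite_dimension_mult_image_part =
  finite_dimension_mult_image[OF subfield_part part_carrier finite_dimension_part]

lemma dim_part_0: "dim0 (D 0) = 1"
  by (rule dimI[OF subfield_part dimension_one[OF subfield_part]])

lemma dim_mult_image_0:
  assumes \<alpha>: "\<alpha> \<in> D d" "\<alpha> \<noteq> \<zero>"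
  shows "dim0 ((\<otimes>) \<alpha> ` D 0) = 1" and "{f \<in> D 0. \<alpha> \<otimes> f = \<zero>} = {\<zero>}"
proof -
  have \<alpha>_carrier: "\<alpha> \<in> carrier R"
    by (rule part_carrier[OF \<alpha>(1)])
  have "f = \<zero>" if f: "f \<in> D 0" "\<alpha> \<otimes> f = \<zero>" for f
  proof (rule ccontr)
    assume "f \<noteq> \<zero>"
    then have inv: "inv f \<in> carrier R" "f \<otimes> inv f = \<one>"
      using subfield_m_inv[OF subfield_part, of f] f(1) part_carrier by auto
    have "\<alpha> = \<alpha> \<otimes> f \<otimes> inv f"
      using inv \<alpha>_carrier part_carrier[OF f(1)] by (simp add: m_assoc)
    then show False
      using f(2) inv(1) \<alpha>(2) by simp
  qed
  then show kernel: "{f \<in> D 0. \<alpha> \<otimes> f = \<zero>} = {\<zero>}"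
    using zero_in_part \<alpha>_carrier by auto
  show "dim0 ((\<otimes>) \<alpha> ` D 0) = 1"
    using dim_mult_image_part[OF \<alpha>(1), of 0]
    unfolding kernel dim_zero_space[OF subfield_part] dim_part_0 by simp
qed

lemma dim_mult_image_exact:
  assumes "annihilator R \<alpha> = PIdl \<beta>" "\<alpha> \<in> D 1" "\<beta> \<in> D 1"
  shows "dim0 ((\<otimes>) \<alpha> ` D (Suc n)) + dim0 ((\<otimes>) \<beta> ` D n) = dim0 (D (Suc n))"
  using dim_mult_image_part[OF assms(2), of "Suc n"] kernel_mult_part[OF assms(1,3), of "Suc n"]
  by simp

lemma exact_zd_pair_dim_mult_image_eq:
  assumes pair: "exact_zd_pair R \<alpha> \<beta>" and \<alpha>: "\<alpha> \<in> D 1" and \<beta>: "\<beta> \<in> D 1"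
  shows "dim0 ((\<otimes>) \<alpha> ` D n) = dim0 ((\<otimes>) \<beta> ` D n)"
proof (induction n)
  case 0
  then show ?case
    using pair dim_mult_image_0(1)[OF \<alpha>] dim_mult_image_0(1)[OF \<beta>]
    by (simp add: exact_zd_pair_def)
next
  case (Suc n)
  have "annihilator R \<alpha> = PIdl \<beta>" "annihilator R \<beta> = PIdl \<alpha>"
    using pair by (simp_all add: exact_zd_pair_def)
  then show ?case
    using Suc dim_mult_image_exact[OF _ \<alpha> \<beta>, of n] dim_mult_image_exact[OF _ \<beta> \<alpha>, of n] by simp
qed

text \<open>In degree \<open>n\<close> the kernels of \<open>\<phi>\<close> and of \<open>\<alpha>\<close> are \<open>\<alpha> D\<^sub>n\<^sub>-\<^sub>1\<close> and \<open>\<beta> D\<^sub>n\<^sub>-\<^sub>1\<close>,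
  which have the same dimension.\<close>

lemma graded_rank_exact_pair_quotient:
  assumes pair: "exact_zd_pair R \<alpha> \<beta>" and \<alpha>: "\<alpha> \<in> D 1" and \<beta>: "\<beta> \<in> D 1"
    and \<phi>: "ring_hom_ring R T \<phi>" "a_kernel R T \<phi> = PIdl \<alpha>"
  shows "graded_rank T (\<lambda>n. \<phi> ` D n) n = dim0 ((\<otimes>) \<alpha> ` D n)"
proof -
  interpret \<phi>: ring_hom_ring R T \<phi> by (rule \<phi>(1))
  have ann: "annihilator R \<alpha> = PIdl \<beta>" and nonzero: "\<alpha> \<noteq> \<zero>"
    using pair by (simp_all add: exact_zd_pair_def)
  have "\<one> \<notin> a_kernel R T \<phi>"
    unfolding \<phi>(2) using pair by (intro one_notin_PIdl) (simp_all add: exact_zd_pair_def)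
  then have nontrivial: "\<one>\<^bsub>T\<^esub> \<noteq> \<zero>\<^bsub>T\<^esub>"
    unfolding a_kernel_def' using \<phi>.hom_one by force
  have "graded_rank T (\<lambda>n. \<phi> ` D n) n = (\<phi>.S.dim over \<phi> ` D 0) (\<phi> ` D n)"
    using \<phi>.S.graded_rank_eq_dim[of "\<lambda>n. \<phi> ` D n"] \<phi>.img_is_subfield(2)[OF subfield_part nontrivial]
      \<phi>.finite_dimension_image[OF subfield_part nontrivial finite_dimension_part] by blast
  moreover have "(\<phi>.S.dim over \<phi> ` D 0) (\<phi> ` D n) + dim0 {f \<in> D n. \<phi> f = \<zero>\<^bsub>T\<^esub>} = dim0 (D n)"
    by (rule \<phi>.dim_image[OF subfield_part nontrivial finite_dimension_part])
  moreover have "{f \<in> D n. \<phi> f = \<zero>\<^bsub>T\<^esub>} = PIdl \<alpha> \<inter> D n"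
    unfolding \<phi>(2)[symmetric] a_kernel_def' using part_carrier by blast
  ultimately have rank: "graded_rank T (\<lambda>n. \<phi> ` D n) n + dim0 (PIdl \<alpha> \<inter> D n) = dim0 (D n)"
    by simp
  show ?thesis
  proof (cases n)
    case 0
    then show ?thesis
      using rank PIdl_Int_part[OF \<alpha>, of 0] dim_zero_space[OF subfield_part] dim_part_0
        dim_mult_image_0(1)[OF \<alpha> nonzero] by simp
  next
    case (Suc k)
    then show ?thesis
      using rank PIdl_Int_part[OF \<alpha>, of n] dim_mult_image_exact[OF ann \<alpha> \<beta>, of k]
        exact_zd_pair_dim_mult_image_eq[OF pair \<alpha> \<beta>, of k] by simp
  qed
qed

lemma graded_hilbert_series_exact_pair_quotient:
  assumes pair: "exact_zd_pair R \<alpha> \<beta>" and \<alpha>: "\<alpha> \<in> D 1" and \<beta>: "\<beta> \<in> D 1"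
    and \<phi>: "ring_hom_ring R T \<phi>" "a_kernel R T \<phi> = PIdl \<alpha>"
  shows "graded_hilbert_series T (\<lambda>n. \<phi> ` D n) = graded_hilbert_series R D * inverse (1 + fps_X)"
proof -
  note quotient_rank = graded_rank_exact_pair_quotient[OF assms]
  have "annihilator R \<alpha> = PIdl \<beta>" "\<alpha> \<noteq> \<zero>"
    using pair by (simp_all add: exact_zd_pair_def)
  then have "dim0 (D (Suc n)) = dim0 ((\<otimes>) \<alpha> ` D (Suc n)) + dim0 ((\<otimes>) \<alpha> ` D n)"
    and "dim0 (D 0) = dim0 ((\<otimes>) \<alpha> ` D 0)" for n
    using dim_mult_image_exact[OF _ \<alpha> \<beta>, of n] exact_zd_pair_dim_mult_image_eq[OF pair \<alpha> \<beta>, of n]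
      dim_mult_image_0(1)[OF \<alpha>] dim_part_0 by simp_all
  then have "graded_hilbert_series R D = graded_hilbert_series T (\<lambda>n. \<phi> ` D n) * (1 + fps_X)"
    by (intro fps_ext) (auto simp: graded_hilbert_series_def quotient_rank graded_rank_eq
        distrib_left gr0_conv_Suc)
  then have "graded_hilbert_series R D * inverse (1 + fps_X) =
      graded_hilbert_series T (\<lambda>n. \<phi> ` D n) * ((1 + fps_X) * inverse (1 + fps_X))"
    by (simp add: mult.assoc)
  also have "(1 + fps_X) * inverse (1 + fps_X :: rat fps) = 1"
    by (rule inverse_mult_eq_1') simp
  finally show ?thesis by simp
qed

corollary graded_hilbert_series_Quot_PIdl:
  assumes pair: "exact_zd_pair R \<alpha> \<beta>" and \<alpha>: "\<alpha> \<in> D 1" and \<beta>: "\<beta> \<in> D 1"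
  shows "graded_hilbert_series (R Quot (PIdl \<alpha>)) (\<lambda>n. (+>) (PIdl \<alpha>) ` D n) =
    graded_hilbert_series R D * inverse (1 + fps_X)"
  using graded_hilbert_series_exact_pair_quotient[OF assms
      ideal.rcos_ring_hom_ring[OF cgenideal_ideal] a_kernel_quotient_PIdl] part_carrier[OF \<alpha>]
  by blast

lemma euler_characteristic_if_hilbert_root:
  assumes p: "fps_of_poly p = graded_hilbert_series R D" "poly p (-1) = 0"
    and top: "\<And>n. n \<ge> 4 \<Longrightarrow> D n = {\<zero>}"
  shows "dim0 (D 0) + dim0 (D 2) = dim0 (D 1) + dim0 (D 3)"
proof -
  have coeff: "Polynomial.coeff p n = of_nat (dim0 (D n))" for n
    using arg_cong[OF p(1), of "\<lambda>f. fps_nth f n"]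
    by (simp add: graded_hilbert_series_def graded_rank_eq)
  have "Polynomial.coeff p n = 0" if "n > 3" for n
    using that top[of n] dim_zero_space[OF subfield_part] by (simp add: coeff)
  then have "degree p \<le> 3"
    by (intro degree_le) blast
  then have "poly p (-1) = (\<Sum>n\<le>3. Polynomial.coeff p n * (-1) ^ n)"
    unfolding poly_altdef by (intro sum.mono_neutral_left) (auto simp: coeff_eq_0)
  then have "rat_of_nat (dim0 (D 0) + dim0 (D 2)) = of_nat (dim0 (D 1) + dim0 (D 3))"
    using p(2) by (simp add: coeff eval_nat_numeral)
  then show ?thesis
    by (simp only: of_nat_eq_iff)
qed

lemma
  assumes \<alpha>: "\<alpha> \<in> D 1" "\<alpha> \<noteq> \<zero>" and \<beta>: "\<beta> \<in> D 1" and \<alpha>\<beta>: "\<alpha> \<otimes> \<beta> = \<zero>"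
    and euler: "dim0 (D 0) + dim0 (D 2) = dim0 (D 1) + dim0 (D 3)"
    and kernel_\<alpha>: "{f \<in> D 2. \<alpha> \<otimes> f = \<zero>} \<subseteq> (\<otimes>) \<beta> ` D 1"
  shows mult_image_part_2_if_short: "(\<otimes>) \<alpha> ` D 2 = D 3"
    and kernel_mult_part_1_if_short: "{f \<in> D 1. \<beta> \<otimes> f = \<zero>} = (\<otimes>) \<alpha> ` D 0"
proof -
  note carrier = part_carrier[OF \<alpha>(1)] part_carrier[OF \<beta>]
  have "\<alpha> \<otimes> (\<beta> \<otimes> f) = \<zero>" if "f \<in> carrier R" for f
    using that \<alpha>\<beta> carrier by (simp add: m_assoc[symmetric])
  then have "{f \<in> D 2. \<alpha> \<otimes> f = \<zero>} = (\<otimes>) \<beta> ` D 1"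
    using kernel_\<alpha> part_mult[OF \<beta>, of _ 1] part_carrier by (auto simp: numeral_2_eq_2)
  then have rank_2: "dim0 ((\<otimes>) \<alpha> ` D 2) + dim0 ((\<otimes>) \<beta> ` D 1) = dim0 (D 2)"
    using dim_mult_image_part[OF \<alpha>(1), of 2] by simp
  let ?N = "{f \<in> D 1. \<beta> \<otimes> f = \<zero>}"
  have rank_1: "dim0 ((\<otimes>) \<beta> ` D 1) + dim0 ?N = dim0 (D 1)"
    by (rule dim_mult_image_part[OF \<beta>])
  have image_\<alpha>: "(\<otimes>) \<alpha> ` D 2 \<subseteq> D 3"
    using part_mult[OF \<alpha>(1), of _ 2] by (auto simp: numeral_3_eq_3)
  have "\<beta> \<otimes> (\<alpha> \<otimes> f) = \<zero>" if "f \<in> carrier R" for f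
    using that \<alpha>\<beta> carrier m_lcomm[of \<beta> \<alpha> f] by (simp add: m_assoc[symmetric])
  then have kernel_\<beta>: "(\<otimes>) \<alpha> ` D 0 \<subseteq> ?N"
    using part_mult[OF \<alpha>(1), of _ 0] part_carrier by auto
  note fin = finite_dimension_mult_image_part finite_dimension_part
    finite_dimension_mult_kernel[OF subfield_part carrier(2) finite_dimension_part]
  have "dim0 ((\<otimes>) \<alpha> ` D 2) \<le> dim0 (D 3)" "dim0 ((\<otimes>) \<alpha> ` D 0) \<le> dim0 ?N"
    using dim_mono[OF subfield_part fin(1,2) image_\<alpha>] dim_mono[OF subfield_part fin(1,3) kernel_\<beta>]
      \<alpha>(1) by blast+
  then have eq: "dim0 ((\<otimes>) \<alpha> ` D 2) = dim0 (D 3)" "dim0 ((\<otimes>) \<alpha> ` D 0) = dim0 ?N"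
    using rank_1 rank_2 euler dim_part_0 dim_mult_image_0(1)[OF \<alpha>] by linarith+
  show "(\<otimes>) \<alpha> ` D 2 = D 3"
    by (rule dim_eq_imp_eq[OF subfield_part fin(1,2) image_\<alpha> eq(1)]) (rule \<alpha>(1))
  show "?N = (\<otimes>) \<alpha> ` D 0"
    by (rule dim_eq_imp_eq[OF subfield_part fin(1,3) kernel_\<beta> eq(2), symmetric]) (rule \<alpha>(1))
qed

lemma annihilator_eq_PIdl_if_short:
  assumes \<alpha>: "\<alpha> \<in> D 1" "\<alpha> \<noteq> \<zero>" and \<beta>: "\<beta> \<in> D 1" "\<beta> \<noteq> \<zero>" and \<alpha>\<beta>: "\<alpha> \<otimes> \<beta> = \<zero>"
    and top: "\<And>n. n \<ge> 4 \<Longrightarrow> D n = {\<zero>}"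
    and euler: "dim0 (D 0) + dim0 (D 2) = dim0 (D 1) + dim0 (D 3)"
    and kernel_\<alpha>: "{f \<in> D 2. \<alpha> \<otimes> f = \<zero>} \<subseteq> (\<otimes>) \<beta> ` D 1"
    and kernel_\<beta>: "{f \<in> D 2. \<beta> \<otimes> f = \<zero>} \<subseteq> (\<otimes>) \<alpha> ` D 1"
  shows "annihilator R \<beta> = PIdl \<alpha>"
proof (rule annihilator_eq_PIdlI[OF \<beta>(1) part_carrier[OF \<alpha>(1)]])
  show "\<beta> \<otimes> \<alpha> = \<zero>"
    using \<alpha>\<beta> m_comm part_carrier \<alpha>(1) \<beta>(1) by metis
  note exactness = mult_image_part_2_if_short[OF \<alpha> \<beta>(1) \<alpha>\<beta> euler kernel_\<alpha>]
    kernel_mult_part_1_if_short[OF \<alpha> \<beta>(1) \<alpha>\<beta> euler kernel_\<alpha>]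
  fix n f assume f: "f \<in> D n" "\<beta> \<otimes> f = \<zero>"
  have image: "f \<in> PIdl \<alpha>" if "f \<in> (\<otimes>) \<alpha> ` D i" for i
    using that PIdl_Int_part[OF \<alpha>(1), of "Suc i"] by auto
  consider "n = 0 \<or> n \<ge> 4" | "n = 1 \<or> n = 2 \<or> n = 3" by linarith
  then show "f \<in> PIdl \<alpha>"
  proof cases
    case 1
    then have "f = \<zero>"
      using f top dim_mult_image_0(2)[OF \<beta>] by blast
    then show ?thesis
      using PIdl_Int_part[OF \<alpha>(1), of 0] by auto
  next
    case 2
    then have "f \<in> (\<otimes>) \<alpha> ` D 0 \<union> (\<otimes>) \<alpha> ` D 1 \<union> (\<otimes>) \<alpha> ` D 2"
      using f exactness kernel_\<beta> by blast
    then show ?thesis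
      using image by blast
  qed
qed

theorem exact_zd_pair_if_short:
  assumes \<alpha>: "\<alpha> \<in> D 1" "\<alpha> \<noteq> \<zero>" and \<beta>: "\<beta> \<in> D 1" "\<beta> \<noteq> \<zero>" and \<alpha>\<beta>: "\<alpha> \<otimes> \<beta> = \<zero>"
    and top: "\<And>n. n \<ge> 4 \<Longrightarrow> D n = {\<zero>}"
    and p: "fps_of_poly p = graded_hilbert_series R D" "poly p (-1) = 0"
    and kernel_\<alpha>: "{f \<in> D 2. \<alpha> \<otimes> f = \<zero>} \<subseteq> (\<otimes>) \<beta> ` D 1"
    and kernel_\<beta>: "{f \<in> D 2. \<beta> \<otimes> f = \<zero>} \<subseteq> (\<otimes>) \<alpha> ` D 1"
  shows "exact_zd_pair R \<alpha> \<beta>"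
proof (rule exact_zd_pairI)
  note euler = euler_characteristic_if_hilbert_root[OF p top]
  have \<beta>\<alpha>: "\<beta> \<otimes> \<alpha> = \<zero>"
    using \<alpha>\<beta> m_comm part_carrier \<alpha>(1) \<beta>(1) by metis
  show "annihilator R \<beta> = PIdl \<alpha>"
    by (rule annihilator_eq_PIdl_if_short[OF \<alpha> \<beta> \<alpha>\<beta> top euler kernel_\<alpha> kernel_\<beta>])
  show "annihilator R \<alpha> = PIdl \<beta>"
    by (rule annihilator_eq_PIdl_if_short[OF \<beta> \<alpha> \<beta>\<alpha> top euler kernel_\<beta> kernel_\<alpha>])
qed (use \<alpha> \<beta> part_carrier in blast)+

end

subsection \<open>Powers of an ideal\<close>

lemma (in ideal) minus_closed_I: "\<lbrakk>x \<in> I; y \<in> I\<rbrakk> \<Longrightarrow> x \<ominus> y \<in> I"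
  by (simp add: a_minus_def)

lemma (in ideal) minus_mem_cancel:
  assumes "x \<in> carrier R" "y \<in> I" "x \<ominus> y \<in> I"
  shows "x \<in> I"
proof -
  have "x = (x \<ominus> y) \<oplus> y"
    using assms by (simp add: a_minus_def a_assoc l_neg)
  then show ?thesis
    using additive_subgroup.a_closed[OF is_additive_subgroup assms(3,2)] by simp
qed

lemma (in ideal) finsum_closed_I:
  assumes "finite A" "f \<in> A \<rightarrow> I"
  shows "finsum R f A \<in> I"
  using assms
proof (induction A)
  case empty
  then show ?case by simp
next
  case (insert i A)
  then have "f i \<in> carrier R" "f \<in> A \<rightarrow> carrier R"
    using Icarr by blast+
  then show ?case
    using insert by simp
qed

lemma (in ideal) finsum_minus_mem:
  assumes "finite A" "f \<in> A \<rightarrow> carrier R" "g \<in> A \<rightarrow> carrier R"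
    and "\<And>i. i \<in> A \<Longrightarrow> f i \<ominus> g i \<in> I"
  shows "finsum R f A \<ominus> finsum R g A \<in> I"
proof -
  have f: "f i \<in> carrier R" and g: "g i \<in> carrier R" if "i \<in> A" for i
    using that assms(2,3) by auto
  have "finsum R f A = finsum R (\<lambda>i. (f i \<ominus> g i) \<oplus> g i) A"
    using f g by (intro finsum_cong') (auto simp: a_minus_def a_assoc l_neg)
  also have "\<dots> = finsum R (\<lambda>i. f i \<ominus> g i) A \<oplus> finsum R g A"
    using f g by (intro finsum_addf) auto
  finally have "finsum R f A \<ominus> finsum R g A =
      (finsum R (\<lambda>i. f i \<ominus> g i) A \<oplus> finsum R g A) \<ominus> finsum R g A"
    by simp
  also have "\<dots> = finsum R (\<lambda>i. f i \<ominus> g i) A"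
    using finsum_closed[of "\<lambda>i. f i \<ominus> g i" A] finsum_closed[OF assms(3)] f g
    unfolding a_minus_def by (subst a_assoc) (auto simp: r_neg)
  finally have "finsum R f A \<ominus> finsum R g A = finsum R (\<lambda>i. f i \<ominus> g i) A" .
  then show ?thesis
    using finsum_closed_I[OF assms(1)] assms(4) by simp
qed

locale cring_ideal = ideal I R + cring R for I and R (structure)
begin

abbreviation ipow :: "nat \<Rightarrow> 'a set" where "ipow \<equiv> ideal_pow R I"

lemma pow_ideal: "ideal (ipow n) R"
  by (induction n) (auto intro: oneideal ideal_prod_is_ideal is_ideal)

lemma pow_carrier: "x \<in> ipow n \<Longrightarrow> x \<in> carrier R"
  using ideal.Icarr[OF pow_ideal] .

lemma pow_zero [simp]: "\<zero> \<in> ipow n"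
  by (rule additive_subgroup.zero_closed[OF ideal.axioms(1)[OF pow_ideal]])

lemma pow_add: "\<lbrakk>x \<in> ipow n; y \<in> ipow n\<rbrakk> \<Longrightarrow> x \<oplus> y \<in> ipow n"
  by (rule additive_subgroup.a_closed[OF ideal.axioms(1)[OF pow_ideal]])

lemma pow_minus: "\<lbrakk>x \<in> ipow n; y \<in> ipow n\<rbrakk> \<Longrightarrow> x \<ominus> y \<in> ipow n"
  by (rule ideal.minus_closed_I[OF pow_ideal])

lemma pow_smult: "\<lbrakk>c \<in> carrier R; x \<in> ipow n\<rbrakk> \<Longrightarrow> c \<otimes> x \<in> ipow n"
  using ideal.I_l_closed[OF pow_ideal] .

lemma pow_Suc_subset: "ipow (Suc n) \<subseteq> ipow n"
  using ideal_prod_inter[OF is_ideal pow_ideal[of n]] by auto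

lemma pow_antimono: "i \<le> j \<Longrightarrow> ipow j \<subseteq> ipow i"
  by (rule lift_Suc_antimono_le[of ipow]) (rule pow_Suc_subset)

lemma ideal_prod_pow: "ideal_prod R (ipow i) (ipow j) = ipow (i + j)"
proof (induction i)
  case 0
  then show ?case
    using ideal_prod_commute[OF oneideal pow_ideal] ideal_prod_one[OF pow_ideal] by simp
next
  case (Suc i)
  then show ?case
    using ideal_prod_assoc[OF is_ideal pow_ideal pow_ideal] by simp
qed

lemma pow_mult: "\<lbrakk>x \<in> ipow i; y \<in> ipow j\<rbrakk> \<Longrightarrow> x \<otimes> y \<in> ipow (i + j)"
  using ideal_prod.prod[of x "ipow i" y "ipow j" R] by (simp add: ideal_prod_pow)

lemma pow_one: "ipow 1 = I"
  by (simp add: ideal_prod_one is_ideal)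

declare ideal_pow.simps(2) [simp del]

lemma coset_eq_iff:
  assumes "x \<in> carrier R" "y \<in> carrier R"
  shows "ipow n +> x = ipow n +> y \<longleftrightarrow> x \<ominus> y \<in> ipow n"
  using quotient_eq_iff_same_a_r_cos[OF pow_ideal assms] by simp

lemma coset_zero: "ipow n +> \<zero> = ipow n"
  using a_rcos_zero[OF pow_ideal pow_zero] .

lemma coset_eq_pow_iff:
  assumes "x \<in> carrier R"
  shows "ipow n +> x = ipow n \<longleftrightarrow> x \<in> ipow n"
  using coset_eq_iff[OF assms zero_closed] coset_zero assms by (simp add: a_minus_def)

lemma some_rep_coset:
  assumes "x \<in> carrier R"
  shows "some_rep (ipow n +> x) \<in> carrier R" "some_rep (ipow n +> x) \<ominus> x \<in> ipow n"
proof -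
  interpret P: ideal "ipow n" R by (rule pow_ideal)
  have "some_rep (ipow n +> x) \<in> ipow n +> x"
    unfolding some_rep_def using P.a_rcos_self[OF assms] by (rule someI)
  then show "some_rep (ipow n +> x) \<in> carrier R" "some_rep (ipow n +> x) \<ominus> x \<in> ipow n"
    using assms P.a_elemrcos_carrier P.a_rcos_module_minus[OF ring_axioms assms] by blast+
qed

lemma some_rep_coset_pow:
  assumes "x \<in> ipow n"
  shows "some_rep (ipow (Suc n) +> x) \<in> ipow n"
proof (rule ideal.minus_mem_cancel[OF pow_ideal _ assms])
  show "some_rep (ipow (Suc n) +> x) \<in> carrier R"
    using some_rep_coset(1) pow_carrier[OF assms] .
  show "some_rep (ipow (Suc n) +> x) \<ominus> x \<in> ipow n"
    using some_rep_coset(2)[OF pow_carrier[OF assms], of "Suc n"] pow_Suc_subset by blast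
qed

end

subsection \<open>The associated graded ring\<close>

definition gr_class :: "('a, 'b) ring_scheme \<Rightarrow> 'a set \<Rightarrow> (nat \<Rightarrow> 'a) \<Rightarrow> nat \<Rightarrow> 'a set" where
  "gr_class R I x = (\<lambda>n. ideal_pow R I (Suc n) +>\<^bsub>R\<^esub> x n)"

definition gr_monom :: "('a, 'b) ring_scheme \<Rightarrow> 'a set \<Rightarrow> nat \<Rightarrow> 'a \<Rightarrow> nat \<Rightarrow> 'a set" where
  "gr_monom R I d x = gr_class R I (\<lambda>n. if n = d then x else \<zero>\<^bsub>R\<^esub>)"

definition gr_component ::
    "('a, 'b) ring_scheme \<Rightarrow> 'a set \<Rightarrow> nat \<Rightarrow> (nat \<Rightarrow> 'a set) \<Rightarrow> nat \<Rightarrow> 'a set" where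
  "gr_component R I d f = (\<lambda>n. if n = d then f n else ideal_pow R I (Suc n))"

text \<open>The associated graded ring is the image of the Rees ring, a subring of the polynomial ring,
  under \<open>gr_class\<close>; its ring axioms are inherited from there.\<close>

lemma
  fixes R (structure)
  shows UP_carrier: "carrier (UP R) = up R"
    and UP_one: "\<one>\<^bsub>UP R\<^esub> = (\<lambda>n. if n = 0 then \<one> else \<zero>)"
    and UP_zero: "\<zero>\<^bsub>UP R\<^esub> = (\<lambda>n. \<zero>)"
    and UP_add: "\<lbrakk>x \<in> up R; y \<in> up R\<rbrakk> \<Longrightarrow> x \<oplus>\<^bsub>UP R\<^esub> y = (\<lambda>n. x n \<oplus> y n)"
    and UP_mult: "\<lbrakk>x \<in> up R; y \<in> up R\<rbrakk> \<Longrightarrow>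
      x \<otimes>\<^bsub>UP R\<^esub> y = (\<lambda>n. \<Oplus>i\<in>{..n}. x i \<otimes> y (n - i))"
  by (simp_all add: UP_def)

definition rees :: "('a, 'b) ring_scheme \<Rightarrow> 'a set \<Rightarrow> (nat \<Rightarrow> 'a) set" where
  "rees R I = {x \<in> up R. \<forall>n. x n \<in> ideal_pow R I n}"

context cring_ideal
begin

abbreviation G where "G \<equiv> gr R I"
abbreviation cls :: "(nat \<Rightarrow> 'a) \<Rightarrow> nat \<Rightarrow> 'a set" where "cls \<equiv> gr_class R I"
abbreviation mon :: "nat \<Rightarrow> 'a \<Rightarrow> nat \<Rightarrow> 'a set" where "mon \<equiv> gr_monom R I"

lemma reesD: "x \<in> rees R I \<Longrightarrow> x n \<in> ipow n" "x \<in> rees R I \<Longrightarrow> x n \<in> carrier R"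
  using pow_carrier by (auto simp: rees_def)

lemma reesI:
  assumes "\<And>n. x n \<in> ipow n" "\<And>n. n > N \<Longrightarrow> x n = \<zero>"
  shows "x \<in> rees R I"
proof -
  have "bound \<zero> N x"
    using assms(2) by unfold_locales
  then show ?thesis
    using assms(1) pow_carrier unfolding rees_def by (blast intro: mem_upI)
qed

lemma rees_bound:
  assumes "x \<in> rees R I"
  obtains N where "\<And>n. n > N \<Longrightarrow> x n = \<zero>"
proof -
  obtain N where "bound \<zero> N x"
    using assms bound_upD unfolding rees_def by blast
  then show ?thesis
    using that[of N] bound.bound by metis
qed

lemma rees_add: "\<lbrakk>x \<in> rees R I; y \<in> rees R I\<rbrakk> \<Longrightarrow> (\<lambda>n. x n \<oplus> y n) \<in> rees R I"
  using up_add_closed pow_add by (simp add: rees_def)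

lemma rees_a_inv: "x \<in> rees R I \<Longrightarrow> (\<lambda>n. \<ominus> x n) \<in> rees R I"
  using up_a_inv_closed additive_subgroup.a_inv_closed[OF ideal.axioms(1)[OF pow_ideal]]
  by (simp add: rees_def)

lemma rees_mult:
  assumes x: "x \<in> rees R I" and y: "y \<in> rees R I"
  shows "(\<lambda>n. \<Oplus>i\<in>{..n}. x i \<otimes> y (n - i)) \<in> rees R I"
proof -
  have "x i \<otimes> y (n - i) \<in> ipow n" if "i \<le> n" for i n
    using pow_mult[OF reesD(1)[OF x, of i] reesD(1)[OF y, of "n - i"]] that by simp
  then have "(\<Oplus>i\<in>{..n}. x i \<otimes> y (n - i)) \<in> ipow n" for n
    by (intro ideal.finsum_closed_I[OF pow_ideal]) auto
  then show ?thesis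
    using up_mult_closed x y by (simp add: rees_def)
qed

lemma rees_monom: "x \<in> ipow d \<Longrightarrow> (\<lambda>n. if n = d then x else \<zero>) \<in> rees R I"
  by (rule reesI[of _ d]) auto

lemma carrier_gr: "carrier G = cls ` rees R I"
proof (intro equalityI subsetI)
  fix f assume "f \<in> carrier G"
  then have f: "\<forall>n. \<exists>x\<in>ipow n. f n = ipow (Suc n) +> x" "finite {n. f n \<noteq> ipow (Suc n)}"
    by (simp_all add: gr_def)
  from f(1) obtain X where X: "\<And>n. X n \<in> ipow n" "\<And>n. f n = ipow (Suc n) +> X n"
    by metis
  from f(2) obtain N where N: "\<And>n. f n \<noteq> ipow (Suc n) \<Longrightarrow> n \<le> N"
    using finite_nat_set_iff_bounded_le by auto
  let ?x = "\<lambda>n. if f n = ipow (Suc n) then \<zero> else X n"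
  have "f = cls ?x"
    using X(2) by (simp add: gr_class_def coset_zero fun_eq_iff)
  moreover have "?x \<in> rees R I"
    by (rule reesI[of _ N]) (use X(1) N in \<open>auto simp: not_le[symmetric]\<close>)
  ultimately show "f \<in> cls ` rees R I" by blast
next
  fix f assume "f \<in> cls ` rees R I"
  then obtain x where x: "x \<in> rees R I" "f = cls x" by blast
  obtain N where N: "\<And>n. n > N \<Longrightarrow> x n = \<zero>"
    using rees_bound[OF x(1)] by blast
  have "f n = ipow (Suc n)" if "n > N" for n
    using N[OF that] x(2) by (simp add: gr_class_def coset_zero)
  then have "{n. f n \<noteq> ipow (Suc n)} \<subseteq> {..N}"
    by (auto simp: not_less[symmetric])
  then have "finite {n. f n \<noteq> ipow (Suc n)}"
    by (rule finite_subset) simp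
  then show "f \<in> carrier G"
    using x reesD by (auto simp: gr_def gr_class_def)
qed

lemma cls_mult:
  assumes x: "\<And>n. x n \<in> ipow n" and y: "\<And>n. y n \<in> ipow n"
  shows "cls x \<otimes>\<^bsub>G\<^esub> cls y = cls (\<lambda>n. \<Oplus>i\<in>{..n}. x i \<otimes> y (n - i))"
proof
  fix n
  let ?r = "\<lambda>i. some_rep (cls x i)" and ?s = "\<lambda>i. some_rep (cls y i)"
  have r: "?r i \<in> ipow i" "?r i \<ominus> x i \<in> ipow (Suc i)"
    and s: "?s i \<in> ipow i" "?s i \<ominus> y i \<in> ipow (Suc i)" for i
    using some_rep_coset_pow[OF x] some_rep_coset_pow[OF y]
      some_rep_coset(2)[OF pow_carrier[OF x]] some_rep_coset(2)[OF pow_carrier[OF y]]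
    by (auto simp: gr_class_def)
  have carr: "x i \<in> carrier R" "y i \<in> carrier R" "?r i \<in> carrier R" "?s i \<in> carrier R" for i
    using x y r s pow_carrier by blast+
  have "(\<Oplus>i\<in>{..n}. ?r i \<otimes> ?s (n - i)) \<ominus> (\<Oplus>i\<in>{..n}. x i \<otimes> y (n - i)) \<in> ipow (Suc n)"
  proof (rule ideal.finsum_minus_mem[OF pow_ideal])
    fix i assume i: "i \<in> {..n}"
    have "?r i \<otimes> ?s (n - i) \<ominus> x i \<otimes> y (n - i) =
      ?r i \<otimes> (?s (n - i) \<ominus> y (n - i)) \<oplus> (?r i \<ominus> x i) \<otimes> y (n - i)"
      using carr[of i] carr[of "n - i"] by algebra
    moreover have "?r i \<otimes> (?s (n - i) \<ominus> y (n - i)) \<in> ipow (Suc n)"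
      using pow_mult[OF r(1)[of i] s(2)[of "n - i"]] i by simp
    moreover have "(?r i \<ominus> x i) \<otimes> y (n - i) \<in> ipow (Suc n)"
      using pow_mult[OF r(2)[of i] y[of "n - i"]] i by simp
    ultimately show "?r i \<otimes> ?s (n - i) \<ominus> x i \<otimes> y (n - i) \<in> ipow (Suc n)"
      using pow_add by simp
  qed (use carr in auto)
  then have "ipow (Suc n) +> (\<Oplus>i\<in>{..n}. ?r i \<otimes> ?s (n - i)) =
      ipow (Suc n) +> (\<Oplus>i\<in>{..n}. x i \<otimes> y (n - i))"
    using carr by (subst coset_eq_iff) (auto intro: finsum_closed)
  then show "(cls x \<otimes>\<^bsub>G\<^esub> cls y) n = cls (\<lambda>n. \<Oplus>i\<in>{..n}. x i \<otimes> y (n - i)) n"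
    by (simp add: gr_def gr_class_def)
qed

lemma cls_add:
  assumes "\<And>n. x n \<in> carrier R" "\<And>n. y n \<in> carrier R"
  shows "cls x \<oplus>\<^bsub>G\<^esub> cls y = cls (\<lambda>n. x n \<oplus> y n)"
  using ideal.a_rcos_sum[OF pow_ideal] assms by (simp add: gr_def gr_class_def)

lemma gr_one: "\<one>\<^bsub>G\<^esub> = mon 0 \<one>"
  by (simp add: gr_def gr_monom_def gr_class_def coset_zero fun_eq_iff)

lemma gr_zero: "\<zero>\<^bsub>G\<^esub> = cls (\<lambda>_. \<zero>)"
  by (simp add: gr_def gr_class_def coset_zero)

lemma cls_eq_iff:
  assumes "\<And>n. x n \<in> carrier R" "\<And>n. y n \<in> carrier R"
  shows "cls x = cls y \<longleftrightarrow> (\<forall>n. x n \<ominus> y n \<in> ipow (Suc n))"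
  using coset_eq_iff assms by (simp add: gr_class_def fun_eq_iff)

lemma cls_eq_zero_iff:
  assumes "\<And>n. x n \<in> carrier R"
  shows "cls x = \<zero>\<^bsub>G\<^esub> \<longleftrightarrow> (\<forall>n. x n \<in> ipow (Suc n))"
  using coset_eq_pow_iff assms by (simp add: gr_class_def fun_eq_iff gr_def)

lemma rees_subring: "subring (rees R I) (UP R)"
proof -
  interpret U: UP_cring R "UP R" by unfold_locales auto
  have up: "x \<in> up R" if "x \<in> rees R I" for x
    using that by (simp add: rees_def)
  show ?thesis
  proof (rule ring.subringI[OF U.UP_ring])
    show "rees R I \<subseteq> carrier (UP R)"
      using up UP_carrier by blast
    show "\<one>\<^bsub>UP R\<^esub> \<in> rees R I"
      unfolding UP_one using rees_monom[of \<one> 0] by simp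
    fix x y assume x: "x \<in> rees R I" and y: "y \<in> rees R I"
    have "(\<lambda>n. \<ominus> x n) \<oplus>\<^bsub>UP R\<^esub> x = \<zero>\<^bsub>UP R\<^esub>"
      using reesD(2)[OF x] by (simp add: UP_add UP_zero up[OF x] up[OF rees_a_inv[OF x]] l_neg)
    then have "\<ominus>\<^bsub>UP R\<^esub> x = (\<lambda>n. \<ominus> x n)"
      using abelian_group.minus_equality[OF ring.is_abelian_group[OF U.UP_ring]] UP_carrier
        up[OF x] up[OF rees_a_inv[OF x]] by metis
    then show "\<ominus>\<^bsub>UP R\<^esub> x \<in> rees R I"
      using rees_a_inv[OF x] by simp
    show "x \<otimes>\<^bsub>UP R\<^esub> y \<in> rees R I"
      using rees_mult[OF x y] by (simp add: UP_mult up x y)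
    show "x \<oplus>\<^bsub>UP R\<^esub> y \<in> rees R I"
      using rees_add[OF x y] by (simp add: UP_add up x y)
  qed
qed

lemma cring_gr: "cring G"
proof -
  interpret U: UP_cring R "UP R" by unfold_locales auto
  let ?T = "UP R \<lparr>carrier := rees R I\<rparr>"
  have "subcring (rees R I) (UP R)"
    by (rule cring.subcringI'[OF U.UP_cring rees_subring])
  then interpret T: cring ?T
    using ring.subcring_iff[OF U.UP_ring subringE(1)[OF rees_subring]] by blast
  have hom: "cls \<in> ring_hom ?T G"
  proof (rule ring_hom_memI)
    show "cls x \<in> carrier G" if "x \<in> carrier ?T" for x
      using that carrier_gr by simp
    fix x y assume "x \<in> carrier ?T" "y \<in> carrier ?T"
    then have x: "x \<in> rees R I" and y: "y \<in> rees R I"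
      by simp_all
    then have up: "x \<in> up R" "y \<in> up R"
      by (simp_all add: rees_def)
    show "cls (x \<otimes>\<^bsub>?T\<^esub> y) = cls x \<otimes>\<^bsub>G\<^esub> cls y"
      by (simp add: UP_mult[OF up] cls_mult[OF reesD(1)[OF x] reesD(1)[OF y]])
    show "cls (x \<oplus>\<^bsub>?T\<^esub> y) = cls x \<oplus>\<^bsub>G\<^esub> cls y"
      by (simp add: UP_add[OF up] cls_add[OF reesD(2)[OF x] reesD(2)[OF y]])
  next
    show "cls \<one>\<^bsub>?T\<^esub> = \<one>\<^bsub>G\<^esub>"
      by (simp add: UP_one gr_one gr_monom_def)
  qed
  have "G \<lparr>carrier := cls ` carrier ?T, zero := cls \<zero>\<^bsub>?T\<^esub>\<rparr> = G"
    using carrier_gr gr_zero by (simp add: UP_zero)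
  then interpret G: ring G
    using T.ring_hom_imp_img_ring[OF hom] by simp
  have "f \<otimes>\<^bsub>G\<^esub> g = g \<otimes>\<^bsub>G\<^esub> f" if "f \<in> carrier G" "g \<in> carrier G" for f g
  proof -
    obtain x y where "x \<in> carrier ?T" "y \<in> carrier ?T" "f = cls x" "g = cls y"
      using \<open>f \<in> carrier G\<close> \<open>g \<in> carrier G\<close> carrier_gr by auto
    then show ?thesis
      using ring_hom_mult[OF hom, of x y] ring_hom_mult[OF hom, of y x] T.m_comm[of x y] by simp
  qed
  then show ?thesis
    by unfold_locales
qed

sublocale gr: cring G
  by (rule cring_gr)

lemma mon_carrier: "x \<in> ipow d \<Longrightarrow> mon d x \<in> carrier G"
  by (simp add: carrier_gr gr_monom_def rees_monom)

lemma mon_mult_cls: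
  assumes a: "a \<in> ipow d" and x: "\<And>n. x n \<in> ipow n"
  shows "mon d a \<otimes>\<^bsub>G\<^esub> cls x = cls (\<lambda>n. if n < d then \<zero> else a \<otimes> x (n - d))"
proof -
  have carr: "a \<in> carrier R" "x n \<in> carrier R" for n
    using a x pow_carrier by blast+
  have "(\<Oplus>i\<in>{..n}. (if i = d then a else \<zero>) \<otimes> x (n - i)) =
      (if n < d then \<zero> else a \<otimes> x (n - d))" for n
  proof -
    have "(\<Oplus>i\<in>{..n}. (if i = d then a else \<zero>) \<otimes> x (n - i)) =
        (\<Oplus>i\<in>{..n}. if d = i then a \<otimes> x (n - i) else \<zero>)"
      using carr by (intro finsum_cong') auto
    also have "\<dots> = (if n < d then \<zero> else a \<otimes> x (n - d))"
    proof (cases "n < d")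
      case True
      then have "(\<Oplus>i\<in>{..n}. if d = i then a \<otimes> x (n - i) else \<zero>) = (\<Oplus>i\<in>{..n}. \<zero>)"
        by (intro finsum_cong') auto
      then show ?thesis using True by simp
    next
      case False
      then show ?thesis
        using carr finsum_singleton[of d "{..n}" "\<lambda>i. a \<otimes> x (n - i)"] by simp
    qed
    finally show ?thesis .
  qed
  then show ?thesis
    unfolding gr_monom_def using a cls_mult[OF _ x] by simp
qed

lemma mon_mult:
  assumes x: "x \<in> ipow d" and y: "y \<in> ipow e"
  shows "mon d x \<otimes>\<^bsub>G\<^esub> mon e y = mon (d + e) (x \<otimes> y)"
proof -
  have "mon d x \<otimes>\<^bsub>G\<^esub> mon e y = cls (\<lambda>n. if n < d then \<zero> else x \<otimes> (if n - d = e then y else \<zero>))"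
    unfolding gr_monom_def[of R I e] by (rule mon_mult_cls[OF x]) (use y in auto)
  also have "(\<lambda>n. if n < d then \<zero> else x \<otimes> (if n - d = e then y else \<zero>)) =
      (\<lambda>n. if n = d + e then x \<otimes> y else \<zero>)"
    using pow_carrier[OF x] by (auto simp: fun_eq_iff)
  finally show ?thesis
    by (simp add: gr_monom_def)
qed

lemma mon_add:
  assumes "x \<in> carrier R" "y \<in> carrier R"
  shows "mon d x \<oplus>\<^bsub>G\<^esub> mon d y = mon d (x \<oplus> y)"
proof -
  have "mon d x \<oplus>\<^bsub>G\<^esub> mon d y = cls (\<lambda>n. (if n = d then x else \<zero>) \<oplus> (if n = d then y else \<zero>))"
    unfolding gr_monom_def using assms by (intro cls_add) auto
  also have "(\<lambda>n. (if n = d then x else \<zero>) \<oplus> (if n = d then y else \<zero>)) =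
      (\<lambda>n. if n = d then x \<oplus> y else \<zero>)"
    by auto
  finally show ?thesis
    by (simp add: gr_monom_def)
qed

lemma mon_eq_iff:
  assumes "x \<in> carrier R" "y \<in> carrier R"
  shows "mon d x = mon d y \<longleftrightarrow> x \<ominus> y \<in> ipow (Suc d)"
  unfolding gr_monom_def using assms by (subst cls_eq_iff) (auto simp: a_minus_def)

lemma mon_eq_zero_iff:
  assumes "x \<in> carrier R"
  shows "mon d x = \<zero>\<^bsub>G\<^esub> \<longleftrightarrow> x \<in> ipow (Suc d)"
  unfolding gr_monom_def using assms by (subst cls_eq_zero_iff) auto

lemma mon_a_inv:
  assumes "x \<in> ipow d"
  shows "\<ominus>\<^bsub>G\<^esub> mon d x = mon d (\<ominus> x)"
proof -
  have "mon d (\<ominus> x) \<oplus>\<^bsub>G\<^esub> mon d x = \<zero>\<^bsub>G\<^esub>"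
    using pow_carrier[OF assms] by (simp add: mon_add mon_eq_zero_iff l_neg)
  moreover have "\<ominus> x \<in> ipow d"
    by (rule additive_subgroup.a_inv_closed[OF ideal.axioms(1)[OF pow_ideal] assms])
  ultimately show ?thesis
    using gr.minus_equality mon_carrier assms by blast
qed

lemma mon_finsum:
  assumes "finite A" "f \<in> A \<rightarrow> ipow d"
  shows "(\<Oplus>\<^bsub>G\<^esub>i\<in>A. mon d (f i)) = mon d (\<Oplus>i\<in>A. f i)"
  using assms
proof (induction A)
  case empty
  then show ?case
    using mon_eq_zero_iff[OF zero_closed] by simp
next
  case (insert i A)
  then have "f \<in> insert i A \<rightarrow> carrier R"
    using pow_carrier by blast
  then show ?case
    using insert mon_carrier by (simp add: mon_add Pi_iff)
qed

lemma gr_part_eq: "gr_part R I d = mon d ` ipow d"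
proof (intro equalityI subsetI)
  fix f assume f: "f \<in> gr_part R I d"
  then obtain x where x: "x \<in> rees R I" "f = cls x"
    by (auto simp: gr_part_def carrier_gr)
  have "f = mon d (x d)"
  proof
    fix n show "f n = mon d (x d) n"
      using f x(2) by (auto simp: gr_part_def gr_monom_def gr_class_def coset_zero)
  qed
  then show "f \<in> mon d ` ipow d"
    using reesD(1)[OF x(1)] by blast
next
  fix f assume "f \<in> mon d ` ipow d"
  then show "f \<in> gr_part R I d"
    using mon_carrier by (auto simp: gr_part_def gr_monom_def gr_class_def coset_zero)
qed

lemma mon_in_part: "x \<in> ipow d \<Longrightarrow> mon d x \<in> gr_part R I d"
  by (simp add: gr_part_eq)

lemma gr_component_cls: "gr_component R I n (cls x) = mon n (x n)"
  by (simp add: gr_component_def gr_monom_def gr_class_def coset_zero fun_eq_iff)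

lemma gr_component_add:
  "gr_component R I n (f \<oplus>\<^bsub>G\<^esub> g) = gr_component R I n f \<oplus>\<^bsub>G\<^esub> gr_component R I n g"
proof -
  have "ipow k <+> ipow k = ipow k" for k
    using ideal.a_rcos_sum[OF pow_ideal zero_closed zero_closed] by (simp add: coset_zero)
  then show ?thesis
    by (simp add: gr_component_def gr_def fun_eq_iff)
qed

lemma gr_component_part:
  assumes "f \<in> gr_part R I k"
  shows "gr_component R I n f = (if n = k then f else \<zero>\<^bsub>G\<^esub>)"
  using assms by (auto simp: gr_component_def gr_part_def gr_def fun_eq_iff)

lemma additive_subgroup_gr_part: "additive_subgroup (gr_part R I d) G"
proof (intro additive_subgroup.intro gr.add.subgroupI)
  show "gr_part R I d \<subseteq> carrier G" "gr_part R I d \<noteq> {}"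
    using mon_carrier pow_zero[of d] by (auto simp: gr_part_eq simp del: pow_zero)
  fix f g assume "f \<in> gr_part R I d" "g \<in> gr_part R I d"
  then obtain x y where xy: "x \<in> ipow d" "f = mon d x" "y \<in> ipow d" "g = mon d y"
    by (auto simp: gr_part_eq)
  then show "f \<oplus>\<^bsub>G\<^esub> g \<in> gr_part R I d"
    using pow_add mon_add pow_carrier mon_in_part by simp
  show "\<ominus>\<^bsub>G\<^esub> f \<in> gr_part R I d"
    using xy mon_in_part by (simp add: mon_a_inv
        additive_subgroup.a_inv_closed[OF ideal.axioms(1)[OF pow_ideal]])
qed

lemma finsum_gr_components:
  assumes "f \<in> carrier G"
  shows "\<exists>A. finite A \<and> f = (\<Oplus>\<^bsub>G\<^esub>n\<in>A. gr_component R I n f)"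
proof -
  obtain x where x: "x \<in> rees R I" "f = cls x"
    using assms carrier_gr by blast
  obtain N where N: "\<And>n. n > N \<Longrightarrow> x n = \<zero>"
    using rees_bound[OF x(1)] by blast
  have "(\<Oplus>\<^bsub>G\<^esub>n\<in>{..<M}. mon n (x n)) = cls (\<lambda>n. if n < M then x n else \<zero>)" for M
  proof (induction M)
    case 0
    then show ?case by (simp add: gr_zero)
  next
    case (Suc M)
    have "(\<Oplus>\<^bsub>G\<^esub>n\<in>{..<Suc M}. mon n (x n)) = mon M (x M) \<oplus>\<^bsub>G\<^esub> cls (\<lambda>n. if n < M then x n else \<zero>)"
      using Suc mon_carrier[OF reesD(1)[OF x(1)]] by (simp add: lessThan_Suc)
    also have "\<dots> = cls (\<lambda>n. (if n = M then x M else \<zero>) \<oplus> (if n < M then x n else \<zero>))"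
      unfolding gr_monom_def using reesD(2)[OF x(1)] by (intro cls_add) auto
    also have "(\<lambda>n. (if n = M then x M else \<zero>) \<oplus> (if n < M then x n else \<zero>)) =
        (\<lambda>n. if n < Suc M then x n else \<zero>)"
      using reesD(2)[OF x(1)] by (auto simp: less_Suc_eq)
    finally show ?case .
  qed
  moreover have "(\<lambda>n. if n < Suc N then x n else \<zero>) = x"
    using N by (auto simp: not_less Suc_le_eq)
  ultimately have "f = (\<Oplus>\<^bsub>G\<^esub>n\<in>{..<Suc N}. gr_component R I n f)"
    unfolding x(2) gr_component_cls by metis
  then show ?thesis by blast
qed

sublocale gr: graded_cring G "gr_part R I" "gr_component R I"
proof (intro graded_cring.intro graded_cring_axioms.intro cring_gr)
  show "f \<otimes>\<^bsub>G\<^esub> g \<in> gr_part R I (i + j)" if "f \<in> gr_part R I i" "g \<in> gr_part R I j" for f g i j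
    using that mon_mult pow_mult by (auto simp: gr_part_eq)
  show "gr_component R I n f \<in> gr_part R I n" if "f \<in> carrier G" for f n
    using that reesD(1) carrier_gr gr_component_cls mon_in_part by force
qed (rule additive_subgroup_gr_part gr_component_add gr_component_part finsum_gr_components
    | assumption)+

lemma initial_form_eq:
  assumes "a \<in> ipow d" "a \<notin> ipow (Suc d)"
  shows "initial_form R I a = mon d a"
proof -
  have "(GREATEST n. a \<in> ipow n) = d"
  proof (rule Greatest_equality)
    fix n assume "a \<in> ipow n"
    then show "n \<le> d"
      using assms(2) pow_antimono[of "Suc d" n] not_less_eq_eq by blast
  qed (rule assms(1))
  then show ?thesis
    by (auto simp: initial_form_def gr_monom_def gr_class_def coset_zero fun_eq_iff)
qed

lemma mon_linear_combination:
  assumes c: "c \<in> {..<length xs} \<rightarrow> carrier R" and xs: "set xs \<subseteq> ipow n"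
  shows "(\<Oplus>\<^bsub>G\<^esub>i\<in>{..<length xs}. mon 0 (c i) \<otimes>\<^bsub>G\<^esub> map (mon n) xs ! i) =
    mon n (\<Oplus>i\<in>{..<length xs}. c i \<otimes> xs ! i)"
proof -
  have coeff: "c i \<in> carrier R" and gen: "xs ! i \<in> ipow n" if "i < length xs" for i
    using c xs nth_mem[OF that] that by auto
  then have mem: "c i \<otimes> xs ! i \<in> ipow n" if "i < length xs" for i
    using that pow_smult by blast
  have "mon 0 (c i) \<otimes>\<^bsub>G\<^esub> map (mon n) xs ! i = mon n (c i \<otimes> xs ! i)" if "i < length xs" for i
    using that mon_mult[of "c i" 0 "xs ! i" n] coeff gen by simp
  then have "(\<Oplus>\<^bsub>G\<^esub>i\<in>{..<length xs}. mon 0 (c i) \<otimes>\<^bsub>G\<^esub> map (mon n) xs ! i) =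
      (\<Oplus>\<^bsub>G\<^esub>i\<in>{..<length xs}. mon n (c i \<otimes> xs ! i))"
    using mem mon_carrier by (intro gr.finsum_cong' refl) auto
  also have "\<dots> = mon n (\<Oplus>i\<in>{..<length xs}. c i \<otimes> xs ! i)"
    using mem by (intro mon_finsum) auto
  finally show ?thesis .
qed

lemma mon_combination_iff:
  assumes xs: "set xs \<subseteq> ipow n" and y: "y \<in> ipow n"
  shows "(\<exists>c \<in> {..<length xs} \<rightarrow> carrier R.
      y \<ominus> (\<Oplus>i\<in>{..<length xs}. c i \<otimes> xs ! i) \<in> ipow (Suc n)) \<longleftrightarrow>
    (\<exists>c \<in> {..<length xs} \<rightarrow> gr_part R I 0.
      mon n y = (\<Oplus>\<^bsub>G\<^esub>i\<in>{..<length xs}. c i \<otimes>\<^bsub>G\<^esub> map (mon n) xs ! i))"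
    (is "(\<exists>c \<in> ?C. ?P c) \<longleftrightarrow> (\<exists>c \<in> ?C'. ?Q c)")
proof -
  have combination: "?P c \<longleftrightarrow> ?Q (\<lambda>i. mon 0 (c i))" if c: "c \<in> ?C" for c
  proof -
    have "(\<Oplus>i\<in>{..<length xs}. c i \<otimes> xs ! i) \<in> carrier R"
      using c xs pow_carrier nth_mem by (intro finsum_closed) blast
    then show ?thesis
      using mon_eq_iff[OF pow_carrier[OF y]] mon_linear_combination[OF c xs] by simp
  qed
  show ?thesis
  proof
    assume "\<exists>c \<in> ?C. ?P c"
    then obtain c where c: "c \<in> ?C" "?P c" by blast
    then have "(\<lambda>i. mon 0 (c i)) \<in> ?C'"
      using mon_in_part[of _ 0] by auto
    then show "\<exists>c \<in> ?C'. ?Q c"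
      using combination[OF c(1)] c(2) by (intro bexI[of _ "\<lambda>i. mon 0 (c i)"]) auto
  next
    assume "\<exists>c \<in> ?C'. ?Q c"
    then obtain g where g: "g \<in> ?C'" "?Q g" by blast
    define c where "c i = inv_into (carrier R) (mon 0) (g i)" for i
    have "g i \<in> mon 0 ` carrier R" if "i < length xs" for i
      using g(1) that gr_part_eq[of 0] by auto
    then have c: "c \<in> ?C" "\<And>i. i < length xs \<Longrightarrow> mon 0 (c i) = g i"
      by (auto simp: c_def inv_into_into f_inv_into_f)
    moreover have "g i \<otimes>\<^bsub>G\<^esub> map (mon n) xs ! i \<in> carrier G" if "i < length xs" for i
    proof -
      have "g i \<in> carrier G" "mon n (xs ! i) \<in> carrier G"
        using g(1) xs that nth_mem[OF that] gr.part_carrier mon_carrier by blast+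
      then show ?thesis
        using that by simp
    qed
    ultimately have "?Q (\<lambda>i. mon 0 (c i))"
      unfolding g(2) by (intro gr.finsum_cong' refl) auto
    then show "\<exists>c \<in> ?C. ?P c"
      using combination[OF c(1)] c(1) by blast
  qed
qed

theorem local_rank_eq_graded_rank: "local_rank R I n = graded_rank G (gr_part R I) n"
proof -
  let ?gr_spans = "\<lambda>fs. \<forall>f \<in> gr_part R I n. \<exists>c \<in> {..<length fs} \<rightarrow> gr_part R I 0.
    f = (\<Oplus>\<^bsub>G\<^esub>i\<in>{..<length fs}. c i \<otimes>\<^bsub>G\<^esub> fs ! i)"
  have spans_iff: "(\<forall>y \<in> ipow n. \<exists>c \<in> {..<length xs} \<rightarrow> carrier R.
      y \<ominus> (\<Oplus>i\<in>{..<length xs}. c i \<otimes> xs ! i) \<in> ipow (Suc n)) \<longleftrightarrow> ?gr_spans (map (mon n) xs)"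
    if "set xs \<subseteq> ipow n" for xs
    using mon_combination_iff[OF that] by (simp add: gr_part_eq[of n] del: nth_map)
  have lists: "set fs \<subseteq> gr_part R I n \<longleftrightarrow> (\<exists>xs. set xs \<subseteq> ipow n \<and> fs = map (mon n) xs)" for fs
    using lists_image[of "mon n" "ipow n"] unfolding gr_part_eq lists_eq_set by blast
  show ?thesis
    unfolding local_rank_def graded_rank_def
  proof (intro arg_cong[where f = Least] ext iffI; elim exE conjE)
    fix r xs
    assume "length xs = r" "set xs \<subseteq> ipow n"
      and "\<forall>y \<in> ipow n. \<exists>c \<in> {..<r} \<rightarrow> carrier R. y \<ominus> (\<Oplus>i\<in>{..<r}. c i \<otimes> xs ! i) \<in> ipow (Suc n)"
    then show "\<exists>fs. length fs = r \<and> set fs \<subseteq> gr_part R I n \<and>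
        (\<forall>f \<in> gr_part R I n. \<exists>c \<in> {..<r} \<rightarrow> gr_part R I 0. f = (\<Oplus>\<^bsub>G\<^esub>i\<in>{..<r}. c i \<otimes>\<^bsub>G\<^esub> fs ! i))"
      using spans_iff[of xs] mon_in_part by (intro exI[of _ "map (mon n) xs"]) auto
  next
    fix r fs
    assume fs: "length fs = r" "set fs \<subseteq> gr_part R I n"
      and "\<forall>f \<in> gr_part R I n. \<exists>c \<in> {..<r} \<rightarrow> gr_part R I 0. f = (\<Oplus>\<^bsub>G\<^esub>i\<in>{..<r}. c i \<otimes>\<^bsub>G\<^esub> fs ! i)"
    then have gr_spans: "?gr_spans fs" by simp
    from fs(2) obtain xs where "set xs \<subseteq> ipow n" "fs = map (mon n) xs"
      using lists by blast
    then show "\<exists>xs. length xs = r \<and> set xs \<subseteq> ipow n \<and>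
        (\<forall>y \<in> ipow n. \<exists>c \<in> {..<r} \<rightarrow> carrier R. y \<ominus> (\<Oplus>i\<in>{..<r}. c i \<otimes> xs ! i) \<in> ipow (Suc n))"
      using gr_spans spans_iff[of xs] fs(1) by (intro exI[of _ xs]) auto
  qed
qed

corollary hilbert_series_eq_graded_hilbert_series:
  "hilbert_series R I = graded_hilbert_series G (gr_part R I)"
  by (simp add: hilbert_series_def graded_hilbert_series_def local_rank_eq_graded_rank)

end

subsection \<open>Functoriality along surjections\<close>

lemma (in ring_hom_ring) image_ideal_prod:
  assumes I: "ideal I R" and J: "ideal J R"
  shows "h ` ideal_prod R I J = ideal_prod S (h ` I) (h ` J)"
proof (intro equalityI subsetI)
  note carr = subsetD[OF R.ideal_prod_in_carrier[OF I J]]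
  fix y assume "y \<in> h ` ideal_prod R I J"
  then obtain x where x: "x \<in> ideal_prod R I J" "y = h x" by blast
  from x(1) have "h x \<in> ideal_prod S (h ` I) (h ` J)"
  proof (induction x rule: ideal_prod.induct)
    case (prod i j)
    then show ?case
      using ideal_prod.prod[of "h i" "h ` I" "h j" "h ` J" S] ideal.Icarr[OF I] ideal.Icarr[OF J]
      by simp
  next
    case (sum s t)
    then show ?case
      using carr by (simp add: ideal_prod.sum)
  qed
  with x(2) show "y \<in> ideal_prod S (h ` I) (h ` J)" by simp
next
  note carr = subsetD[OF R.ideal_prod_in_carrier[OF I J]]
  fix y assume "y \<in> ideal_prod S (h ` I) (h ` J)"
  then show "y \<in> h ` ideal_prod R I J"
  proof (induction y rule: ideal_prod.induct)
    case (prod i j)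
    then obtain s t where "s \<in> I" "t \<in> J" "i = h s" "j = h t" by blast
    then show ?case
      using ideal_prod.prod[of s I t J R] ideal.Icarr[OF I] ideal.Icarr[OF J]
      by (intro image_eqI[of _ h "s \<otimes> t"]) simp_all
  next
    case (sum s t)
    then obtain x y where "x \<in> ideal_prod R I J" "y \<in> ideal_prod R I J" "s = h x" "t = h y"
      by blast
    then show ?case
      using carr ideal_prod.sum by (intro image_eqI[of _ h "x \<oplus> y"]) simp_all
  qed
qed

locale cring_ideal_surjection =
  source: cring_ideal I R + target: cring_ideal J S + phi: ring_hom_cring R S \<phi>
  for I and R (structure) and J and S (structure) and \<phi> +
  assumes surj: "\<phi> ` carrier R = carrier S" and J_eq: "J = \<phi> ` I"
begin

lemma ideal_pow_image: "ideal_pow S J n = \<phi> ` ideal_pow R I n"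
proof (induction n)
  case 0
  then show ?case using surj by simp
next
  case (Suc n)
  then show ?case
    using phi.ring.image_ideal_prod[OF source.is_ideal source.pow_ideal] J_eq
    by (simp add: ideal_pow.simps(2))
qed

lemma phi_minus: "\<lbrakk>x \<in> carrier R; y \<in> carrier R\<rbrakk> \<Longrightarrow> \<phi> (x \<ominus> y) = \<phi> x \<ominus>\<^bsub>S\<^esub> \<phi> y"
  by (simp add: a_minus_def)

lemma phi_pow: "x \<in> ideal_pow R I n \<Longrightarrow> \<phi> x \<in> ideal_pow S J n"
  by (simp add: ideal_pow_image)

abbreviation gmap where "gmap \<equiv> gr_map R I S J \<phi>"

lemma gr_map_cls:
  assumes "\<And>n. x n \<in> carrier R"
  shows "gmap (gr_class R I x) = gr_class S J (\<lambda>n. \<phi> (x n))"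
proof
  fix n
  let ?r = "some_rep (ideal_pow R I (Suc n) +> x n)"
  have r: "?r \<in> carrier R" "?r \<ominus> x n \<in> ideal_pow R I (Suc n)"
    using source.some_rep_coset[OF assms] by blast+
  then have "\<phi> ?r \<ominus>\<^bsub>S\<^esub> \<phi> (x n) \<in> ideal_pow S J (Suc n)"
    using phi_pow phi_minus[OF r(1) assms] by metis
  then show "gmap (gr_class R I x) n = gr_class S J (\<lambda>n. \<phi> (x n)) n"
    using r assms target.coset_eq_iff[of "\<phi> ?r" "\<phi> (x n)"] by (simp add: gr_map_def gr_class_def)
qed

lemma gr_map_monom:
  assumes "x \<in> carrier R"
  shows "gmap (gr_monom R I d x) = gr_monom S J d (\<phi> x)"
proof -
  have "(\<lambda>n. \<phi> (if n = d then x else \<zero>)) = (\<lambda>n. if n = d then \<phi> x else \<zero>\<^bsub>S\<^esub>)"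
    by auto
  then show ?thesis
    unfolding gr_monom_def using assms gr_map_cls[of "\<lambda>n. if n = d then x else \<zero>"] by simp
qed

lemma rees_image:
  assumes "x \<in> rees R I"
  shows "(\<lambda>n. \<phi> (x n)) \<in> rees S J"
proof -
  obtain N where "\<And>n. n > N \<Longrightarrow> x n = \<zero>"
    using source.rees_bound[OF assms] by blast
  then show ?thesis
    using source.reesD(1)[OF assms] phi_pow by (intro target.reesI[of _ N]) auto
qed

lemma gr_map_ring_hom: "gmap \<in> ring_hom (gr R I) (gr S J)"
proof (rule ring_hom_memI)
  show "gmap f \<in> carrier (gr S J)" if "f \<in> carrier (gr R I)" for f
    using that source.carrier_gr target.carrier_gr gr_map_cls source.reesD(2) rees_image by auto
  show "gmap \<one>\<^bsub>gr R I\<^esub> = \<one>\<^bsub>gr S J\<^esub>"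
    unfolding source.gr_one target.gr_one by (simp add: gr_map_monom)
  fix f g assume "f \<in> carrier (gr R I)" "g \<in> carrier (gr R I)"
  then obtain x y where xy: "x \<in> rees R I" "f = gr_class R I x" "y \<in> rees R I" "g = gr_class R I y"
    using source.carrier_gr by auto
  note x = source.reesD[OF xy(1)] and y = source.reesD[OF xy(3)]
  have "\<phi> (\<Oplus>i\<in>{..n}. x i \<otimes> y (n - i)) = (\<Oplus>\<^bsub>S\<^esub>i\<in>{..n}. \<phi> (x i) \<otimes>\<^bsub>S\<^esub> \<phi> (y (n - i)))" for n
    using x y phi.hom_finsum[of "\<lambda>i. x i \<otimes> y (n - i)" "{..n}"] by (simp add: Pi_def comp_def)
  then show "gmap (f \<otimes>\<^bsub>gr R I\<^esub> g) = gmap f \<otimes>\<^bsub>gr S J\<^esub> gmap g"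
    using xy x y phi_pow source.rees_mult[OF xy(1,3)]
    by (simp add: source.cls_mult target.cls_mult gr_map_cls source.reesD(2))
  show "gmap (f \<oplus>\<^bsub>gr R I\<^esub> g) = gmap f \<oplus>\<^bsub>gr S J\<^esub> gmap g"
    using xy x y by (simp add: source.cls_add target.cls_add gr_map_cls)
qed

sublocale gmap: ring_hom_ring "gr R I" "gr S J" gmap
  by (rule ring_hom_ringI2[OF source.gr.ring_axioms target.gr.ring_axioms gr_map_ring_hom])

lemma gr_map_part: "gmap ` gr_part R I n = gr_part S J n"
proof -
  have "gmap (gr_monom R I n x) = gr_monom S J n (\<phi> x)" if "x \<in> ideal_pow R I n" for x
    using gr_map_monom source.pow_carrier that by blast
  then show ?thesis
    unfolding source.gr_part_eq target.gr_part_eq ideal_pow_image by (force simp: image_image)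
qed

lemma gr_map_surj: "gmap ` carrier (gr R I) = carrier (gr S J)"
proof
  show "gmap ` carrier (gr R I) \<subseteq> carrier (gr S J)"
    using gmap.hom_closed by blast
  show "carrier (gr S J) \<subseteq> gmap ` carrier (gr R I)"
  proof
    fix g assume "g \<in> carrier (gr S J)"
    then obtain y where y: "y \<in> rees S J" "g = gr_class S J y"
      using target.carrier_gr by auto
    obtain N where N: "\<And>n. n > N \<Longrightarrow> y n = \<zero>\<^bsub>S\<^esub>"
      using target.rees_bound[OF y(1)] by blast
    have "\<forall>n. \<exists>x\<in>ideal_pow R I n. \<phi> x = y n"
      using target.reesD(1)[OF y(1)] ideal_pow_image by (metis imageE)
    then obtain X where X: "\<And>n. X n \<in> ideal_pow R I n" "\<And>n. \<phi> (X n) = y n"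
      by metis
    let ?x = "\<lambda>n. if n > N then \<zero> else X n"
    have x: "?x \<in> rees R I"
      by (rule source.reesI[of _ N]) (use X in auto)
    have "gmap (gr_class R I ?x) = g"
      using gr_map_cls[of ?x] source.reesD(2)[OF x] X N y(2)
      by (auto intro!: arg_cong[where f = "gr_class S J"])
    then show "g \<in> gmap ` carrier (gr R I)"
      using x source.carrier_gr by blast
  qed
qed

abbreviation gr_kernel where "gr_kernel \<equiv> a_kernel (gr R I) (gr S J) gmap"

lemma gr_quotient_iso:
  "\<exists>h. h \<in> ring_iso (gr R I Quot gr_kernel) (gr S J)
     \<and> (\<forall>f \<in> carrier (gr R I). h (gr_kernel +>\<^bsub>gr R I\<^esub> f) = gmap f)
     \<and> (\<forall>n. h ` (\<lambda>f. gr_kernel +>\<^bsub>gr R I\<^esub> f) ` gr_part R I n = gr_part S J n)"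
proof (intro exI[of _ "\<lambda>X. the_elem (gmap ` X)"] conjI ballI allI)
  let ?h = "\<lambda>X. the_elem (gmap ` X)"
  show "?h \<in> ring_iso (gr R I Quot gr_kernel) (gr S J)"
    by (rule gmap.FactRing_iso_set[OF gr_map_surj])
  show h: "?h (gr_kernel +>\<^bsub>gr R I\<^esub> f) = gmap f" if "f \<in> carrier (gr R I)" for f
    using gmap.the_elem_simp[OF that] .
  show "?h ` (\<lambda>f. gr_kernel +>\<^bsub>gr R I\<^esub> f) ` gr_part R I n = gr_part S J n" for n
    unfolding gr_map_part[of n, symmetric] image_image
    by (intro image_cong refl h) (rule source.gr.part_carrier)
qed

end

subsection \<open>Initial forms and quotients by an element\<close>

lemma (in cring_ideal) mult_preimage_pow_Suc:
  assumes a: "a \<in> ipow d" and b: "b \<in> ipow e" and ab: "a \<otimes> b = \<zero>"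
    and ann: "annihilator G (mon d a) = PIdl\<^bsub>G\<^esub> (mon e b)"
    and y: "y \<in> ipow k" "a \<otimes> y \<in> ipow (Suc (d + k))"
  shows "\<exists>y'\<in>ipow (Suc k). a \<otimes> y' = a \<otimes> y"
proof -
  note carr = pow_carrier[OF a] pow_carrier[OF b] pow_carrier[OF y(1)]
  have "mon d a \<otimes>\<^bsub>G\<^esub> mon k y = \<zero>\<^bsub>G\<^esub>"
    using y(2) carr by (simp add: mon_mult[OF a y(1)] mon_eq_zero_iff)
  then have "mon k y \<in> {f \<in> gr_part R I k. mon d a \<otimes>\<^bsub>G\<^esub> f = \<zero>\<^bsub>G\<^esub>}"
    using mon_in_part[OF y(1)] by blast
  then have mon_y: "mon k y \<in> (if k < e then {\<zero>\<^bsub>G\<^esub>} else (\<otimes>\<^bsub>G\<^esub>) (mon e b) ` gr_part R I (k - e))"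
    by (simp only: gr.kernel_mult_part[OF ann mon_in_part[OF b]])
  show ?thesis
  proof (cases "k < e")
    case True
    then have "y \<in> ipow (Suc k)"
      using mon_y carr by (simp add: mon_eq_zero_iff)
    then show ?thesis by blast
  next
    case False
    then obtain z where z: "z \<in> ipow (k - e)" "mon k y = mon e b \<otimes>\<^bsub>G\<^esub> mon (k - e) z"
      using mon_y by (auto simp: gr_part_eq)
    have z_carr: "z \<in> carrier R"
      using pow_carrier[OF z(1)] .
    have "mon k y = mon k (b \<otimes> z)"
      using z(2) False by (simp add: mon_mult[OF b z(1)])
    then have "y \<ominus> b \<otimes> z \<in> ipow (Suc k)"
      using mon_eq_iff carr z_carr by simp
    moreover have "a \<otimes> (y \<ominus> b \<otimes> z) = a \<otimes> y \<ominus> (a \<otimes> b) \<otimes> z"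
      using carr z_carr by algebra
    then have "a \<otimes> (y \<ominus> b \<otimes> z) = a \<otimes> y"
      using ab carr z_carr by (simp add: a_minus_def)
    ultimately show ?thesis by blast
  qed
qed

lemma (in cring_ideal) mult_preimage_pow:
  assumes "a \<in> ipow d" "b \<in> ipow e" "a \<otimes> b = \<zero>"
    and "annihilator G (mon d a) = PIdl\<^bsub>G\<^esub> (mon e b)"
    and y: "y \<in> carrier R" "a \<otimes> y \<in> ipow (d + n)"
  shows "\<exists>y'\<in>ipow n. a \<otimes> y' = a \<otimes> y"
  using y(2)
proof (induction n)
  case 0
  then show ?case using y(1) by auto
next
  case (Suc n)
  then have "a \<otimes> y \<in> ipow (d + n)"
    using pow_Suc_subset by auto
  then obtain y' where y': "y' \<in> ipow n" "a \<otimes> y' = a \<otimes> y"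
    using Suc.IH by blast
  then have "a \<otimes> y' \<in> ipow (Suc (d + n))"
    using Suc.prems by simp
  from mult_preimage_pow_Suc[OF assms(1-4) y'(1) this] show ?case
    using y'(2) by metis
qed

context cring_ideal_surjection
begin

lemma phi_mem_pow_iff:
  assumes ker: "a_kernel R S \<phi> = PIdl a" and a: "a \<in> carrier R" and x: "x \<in> carrier R"
  shows "\<phi> x \<in> ideal_pow S J k \<longleftrightarrow> (\<exists>r\<in>carrier R. x \<ominus> a \<otimes> r \<in> ideal_pow R I k)"
proof
  assume "\<phi> x \<in> ideal_pow S J k"
  then obtain z where z: "z \<in> ideal_pow R I k" "\<phi> x = \<phi> z"
    unfolding ideal_pow_image by blast
  have z_carr: "z \<in> carrier R"
    by (rule source.pow_carrier[OF z(1)])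
  have "\<phi> (x \<ominus> z) = \<zero>\<^bsub>S\<^esub>"
    using z(2) z_carr x by (simp add: phi_minus a_minus_def target.r_neg)
  then have "x \<ominus> z \<in> PIdl a"
    unfolding ker[symmetric] a_kernel_def' using x z_carr by simp
  then obtain r where "r \<in> carrier R" "x \<ominus> z = r \<otimes> a"
    unfolding cgenideal_def by blast
  then have r: "r \<in> carrier R" "x \<ominus> z = a \<otimes> r"
    using source.m_comm[OF a] by simp_all
  moreover have "x \<ominus> (x \<ominus> z) = z"
    using x z_carr by algebra
  ultimately show "\<exists>r\<in>carrier R. x \<ominus> a \<otimes> r \<in> ideal_pow R I k"
    using z(1) by metis
next
  assume "\<exists>r\<in>carrier R. x \<ominus> a \<otimes> r \<in> ideal_pow R I k"
  then obtain r where r: "r \<in> carrier R" "x \<ominus> a \<otimes> r \<in> ideal_pow R I k" by blast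
  have "a \<in> a_kernel R S \<phi>"
    unfolding ker by (rule source.cgenideal_self[OF a])
  then have "\<phi> a = \<zero>\<^bsub>S\<^esub>"
    unfolding a_kernel_def' by blast
  then have "\<phi> (x \<ominus> a \<otimes> r) = \<phi> x \<ominus>\<^bsub>S\<^esub> \<zero>\<^bsub>S\<^esub>"
    using x a r(1) by (simp add: phi_minus)
  then have "\<phi> (x \<ominus> a \<otimes> r) = \<phi> x"
    using x by (simp add: a_minus_def)
  then show "\<phi> x \<in> ideal_pow S J k"
    using phi_pow[OF r(2)] by simp
qed

lemma gr_monom_kernel_imp_PIdl:
  assumes ker: "a_kernel R S \<phi> = PIdl a"
    and a: "a \<in> ideal_pow R I d" and b: "b \<in> ideal_pow R I e" "a \<otimes> b = \<zero>"
    and ann: "annihilator (gr R I) (gr_monom R I d a) = PIdl\<^bsub>gr R I\<^esub> (gr_monom R I e b)"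
    and x: "x \<in> ideal_pow R I n" "\<phi> x \<in> ideal_pow S J (Suc n)"
  shows "gr_monom R I n x \<in> PIdl\<^bsub>gr R I\<^esub> (gr_monom R I d a)"
proof -
  note carr = source.pow_carrier[OF a] source.pow_carrier[OF x(1)]
  obtain r where r: "r \<in> carrier R" "x \<ominus> a \<otimes> r \<in> ideal_pow R I (Suc n)"
    using x(2) phi_mem_pow_iff[OF ker carr] by blast
  have monom_x: "gr_monom R I n x = gr_monom R I n (a \<otimes> r)"
    using r carr by (simp add: source.mon_eq_iff)
  have "gr_monom R I n (a \<otimes> r) \<in>
      (if n < d then {\<zero>\<^bsub>gr R I\<^esub>} else (\<otimes>\<^bsub>gr R I\<^esub>) (gr_monom R I d a) ` gr_part R I (n - d))"
  proof (cases "n < d")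
    case True
    have "a \<otimes> r \<in> ideal_pow R I d"
      using source.pow_mult[OF a, of r 0] r(1) by simp
    then have "a \<otimes> r \<in> ideal_pow R I (Suc n)"
      using source.pow_antimono[of "Suc n" d] True by auto
    then show ?thesis
      using True r(1) carr by (simp add: source.mon_eq_zero_iff)
  next
    case False
    have "x \<ominus> (x \<ominus> a \<otimes> r) = a \<otimes> r"
      using r(1) carr by algebra
    then have "a \<otimes> r \<in> ideal_pow R I (d + (n - d))"
      using source.pow_minus[OF x(1), of "x \<ominus> a \<otimes> r"] r(2) source.pow_Suc_subset False by auto
    then obtain y where y: "y \<in> ideal_pow R I (n - d)" "a \<otimes> y = a \<otimes> r"
      using source.mult_preimage_pow[OF a b ann r(1)] by blast
    have "gr_monom R I n (a \<otimes> r) = gr_monom R I d a \<otimes>\<^bsub>gr R I\<^esub> gr_monom R I (n - d) y"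
      using False y(2) by (simp add: source.mon_mult[OF a y(1)])
    then show ?thesis
      using source.mon_in_part[OF y(1)] False by auto
  qed
  then show ?thesis
    unfolding monom_x using source.gr.PIdl_Int_part[OF source.mon_in_part[OF a], of n] by blast
qed

theorem gr_map_kernel_eq_PIdl:
  assumes ker: "a_kernel R S \<phi> = PIdl a"
    and a: "a \<in> ideal_pow R I d" and b: "b \<in> ideal_pow R I e" "a \<otimes> b = \<zero>"
    and ann: "annihilator (gr R I) (gr_monom R I d a) = PIdl\<^bsub>gr R I\<^esub> (gr_monom R I e b)"
  shows "gr_kernel = PIdl\<^bsub>gr R I\<^esub> (gr_monom R I d a)"
proof
  let ?\<alpha> = "gr_monom R I d a"
  have a_carr: "a \<in> carrier R" and \<alpha>_carr: "?\<alpha> \<in> carrier (gr R I)"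
    using source.pow_carrier[OF a] source.mon_carrier[OF a] .
  have "a \<in> a_kernel R S \<phi>"
    unfolding ker by (rule source.cgenideal_self[OF a_carr])
  then have "\<phi> a = \<zero>\<^bsub>S\<^esub>"
    unfolding a_kernel_def' by blast
  then have "gmap ?\<alpha> = \<zero>\<^bsub>gr S J\<^esub>"
    using a_carr by (simp add: gr_map_monom target.mon_eq_zero_iff)
  then have "?\<alpha> \<in> gr_kernel"
    unfolding a_kernel_def' using \<alpha>_carr by blast
  then show "PIdl\<^bsub>gr R I\<^esub> ?\<alpha> \<subseteq> gr_kernel"
    by (rule source.gr.cgenideal_minimal[OF gmap.kernel_is_ideal])
  show "gr_kernel \<subseteq> PIdl\<^bsub>gr R I\<^esub> ?\<alpha>"
  proof
    fix f assume "f \<in> gr_kernel"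
    then obtain x where x: "x \<in> rees R I" "f = gr_class R I x" "gmap f = \<zero>\<^bsub>gr S J\<^esub>"
      using source.carrier_gr unfolding a_kernel_def' by blast
    have "gr_class S J (\<lambda>n. \<phi> (x n)) = \<zero>\<^bsub>gr S J\<^esub>"
      using x gr_map_cls[OF source.reesD(2)[OF x(1)]] by simp
    then have "\<phi> (x n) \<in> ideal_pow S J (Suc n)" for n
      using target.cls_eq_zero_iff[of "\<lambda>n. \<phi> (x n)"] source.reesD(2)[OF x(1)] by simp
    then have "gr_component R I n f \<in> PIdl\<^bsub>gr R I\<^esub> ?\<alpha>" for n
      unfolding x(2) source.gr_component_cls
      using gr_monom_kernel_imp_PIdl[OF assms source.reesD(1)[OF x(1)]] by blast
    then show "f \<in> PIdl\<^bsub>gr R I\<^esub> ?\<alpha>"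
      using source.gr.mem_ideal_if_components_mem[OF source.gr.cgenideal_ideal[OF \<alpha>_carr]]
        x(1,2) source.carrier_gr by blast
  qed
qed

end

lemma (in cring_ideal) cring_ideal_surjection_quotient_PIdl:
  assumes "a \<in> carrier R"
  shows "cring_ideal_surjection I R ((+>) (PIdl a) ` I) (R Quot (PIdl a)) ((+>) (PIdl a))"
proof -
  interpret A: ideal "PIdl a" R by (rule cgenideal_ideal[OF assms])
  have "cring (R Quot (PIdl a))"
    by (rule A.quotient_is_cring[OF is_cring])
  moreover have "ideal ((+>) (PIdl a) ` I) (R Quot (PIdl a))"
    by (rule ring_ideal_imp_quot_ideal[OF A.is_ideal is_ideal])
  moreover have "ring_hom_cring R (R Quot (PIdl a)) ((+>) (PIdl a))"
    by (rule A.rcos_ring_hom_cring[OF is_cring])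
  moreover have "(+>) (PIdl a) ` carrier R = carrier (R Quot (PIdl a))"
    by (auto simp: FactRing_simps)
  ultimately show ?thesis
    using cring_ideal_axioms
    by (simp add: cring_ideal_surjection_def cring_ideal_surjection_axioms_def cring_ideal_def)
qed

subsection \<open>Noetherian rings with a maximal ideal\<close>

lemma (in ring_hom_ring) subfield_image_if_maximal_kernel:
  assumes "cring R" and max: "maximalideal (a_kernel R S h) R"
  shows "subfield (h ` carrier R) S"
proof -
  let ?Q = "R Quot (a_kernel R S h)" and ?h = "\<lambda>X. the_elem (h ` X)"
  let ?H = "S\<lparr>carrier := h ` carrier R\<rparr>"
  have field: "field ?Q"
    by (rule maximalideal.quotient_is_field[OF max assms(1)])
  have iso: "?h \<in> ring_iso ?Q ?H"
    by (rule FactRing_iso_set_aux)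
  have "?h \<zero>\<^bsub>?Q\<^esub> = \<zero>\<^bsub>?H\<^esub>"
    using ring_hom_zero[OF _ field.is_ring[OF field] img_is_ring, of ?h] iso
    by (simp add: ring_iso_def)
  then have "field ?H"
    using field.ring_iso_imp_img_field[OF field iso] by simp
  then show ?thesis
    by (rule S.subfield_iff(1)) auto
qed

lemma (in cring_ideal) ring_hom_mon_0: "ring_hom_ring R G (mon 0)"
  by (intro ring_hom_ringI2 ring_axioms gr.ring_axioms ring_hom_memI)
    (simp_all add: mon_carrier mon_mult mon_add gr_one)

lemma (in cring_ideal) a_kernel_mon_0: "a_kernel R G (mon 0) = I"
  unfolding a_kernel_def' using a_subset by (auto simp: mon_eq_zero_iff pow_one[simplified])

lemma (in cring_ideal) ideal_mon_preimage:
  assumes "subalgebra (gr_part R I 0) V G"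
  shows "ideal {x \<in> ipow n. mon n x \<in> V} R"
proof -
  interpret V: subalgebra "gr_part R I 0" V G by (rule assms)
  interpret P: ideal "ipow n" R by (rule pow_ideal)
  let ?P = "{x \<in> ipow n. mon n x \<in> V}"
  show ?thesis
  proof (rule idealI[OF ring_axioms])
    show "subgroup ?P (add_monoid R)"
    proof (rule add.subgroupI)
      show "?P \<subseteq> carrier R"
        using P.a_subset by blast
      have "mon n \<zero> \<in> V"
        using V.one_closed mon_eq_zero_iff[OF zero_closed] by simp
      then show "?P \<noteq> {}"
        using pow_zero[of n] by blast
      fix x y assume "x \<in> ?P" "y \<in> ?P"
      then have xy: "x \<in> ipow n" "mon n x \<in> V" "y \<in> ipow n" "mon n y \<in> V"
        by simp_all
      show "\<ominus> x \<in> ?P"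
        using V.m_inv_closed[OF xy(2)] P.a_inv_closed[OF xy(1)] mon_a_inv[OF xy(1)]
        by (simp add: a_inv_def)
      show "x \<oplus> y \<in> ?P"
        using V.m_closed[OF xy(2,4)] pow_add[OF xy(1,3)] mon_add[of x y n] xy by simp
    qed
    fix x c assume "x \<in> ?P" and c: "c \<in> carrier R"
    then have x: "x \<in> ipow n" "mon n x \<in> V"
      by simp_all
    have "mon 0 c \<otimes>\<^bsub>G\<^esub> mon n x = mon n (c \<otimes> x)"
      using mon_mult[of c 0 x n] c x(1) by simp
    then show "c \<otimes> x \<in> ?P"
      using V.smult_closed[OF mon_in_part x(2), of c] pow_smult[OF c x(1)] c by simp
    then show "x \<otimes> c \<in> ?P"
      using m_comm[OF pow_carrier[OF x(1)] c] by simp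
  qed
qed

locale noetherian_maximal = cring_ideal m R + noetherian_ring R + maximalideal m R
  for m and R (structure)
begin

lemma subfield_gr_part: "subfield (gr_part R m 0) G"
proof -
  have "maximalideal (a_kernel R G (mon 0)) R"
    unfolding a_kernel_mon_0 by (rule maximalideal_axioms)
  from ring_hom_ring.subfield_image_if_maximal_kernel[OF ring_hom_mon_0 is_cring this]
  show ?thesis
    unfolding gr_part_eq ideal_pow.simps(1) .
qed

lemma finite_dimension_gr_part: "gr.finite_dimension (gr_part R m 0) (gr_part R m n)"
proof -
  let ?K = "gr_part R m 0"
  obtain A where A: "A \<subseteq> carrier R" "finite A" "ipow n = Idl A"
    using finetely_gen[OF pow_ideal] by blast
  obtain xs where xs: "set xs = A"
    using finite_list[OF A(2)] by blast
  have A_pow: "A \<subseteq> ipow n"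
    unfolding A(3) by (rule genideal_self[OF A(1)])
  let ?V = "gr.Span ?K (map (mon n) xs)"
  have gens: "set (map (mon n) xs) \<subseteq> carrier G"
    using A_pow xs mon_carrier by auto
  have "ideal {x \<in> ipow n. mon n x \<in> ?V} R"
    by (rule ideal_mon_preimage[OF gr.Span_is_subalgebra[OF subfield_gr_part gens]])
  moreover have "A \<subseteq> {x \<in> ipow n. mon n x \<in> ?V}"
    using A_pow gr.Span_base_incl[OF subfield_gr_part gens] xs by auto
  ultimately have "ipow n \<subseteq> {x \<in> ipow n. mon n x \<in> ?V}"
    unfolding A(3) by (rule genideal_minimal)
  then have "gr_part R m n \<subseteq> ?V"
    by (auto simp: gr_part_eq simp del: gr.Span.simps)
  then show ?thesis
    by (rule gr.subalbegra_incl_imp_finite_dimension[OF subfield_gr_part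
          gr.Span_finite_dimension[OF subfield_gr_part gens] gr.subalgebra_part])
qed

sublocale gr: graded_algebra G "gr_part R m" "gr_component R m"
  by (intro graded_algebra.intro graded_algebra_axioms.intro gr.graded_cring_axioms
      subfield_gr_part finite_dimension_gr_part)

lemma kernel_mult_gr_part_2:
  assumes pow4: "ipow 4 = {\<zero>}" and a: "a \<in> ipow 1"
    and b: "b \<in> ipow 1" "b \<notin> ipow 2" and ann: "annihilator R a = PIdl b"
  shows "{f \<in> gr_part R m 2. mon 1 a \<otimes>\<^bsub>G\<^esub> f = \<zero>\<^bsub>G\<^esub>} \<subseteq> (\<otimes>\<^bsub>G\<^esub>) (mon 1 b) ` gr_part R m 1"
proof
  note carr = pow_carrier[OF a] pow_carrier[OF b(1)]
  fix f assume "f \<in> {f \<in> gr_part R m 2. mon 1 a \<otimes>\<^bsub>G\<^esub> f = \<zero>\<^bsub>G\<^esub>}"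
  then obtain x where x: "x \<in> ipow 2" "f = mon 2 x" "mon 1 a \<otimes>\<^bsub>G\<^esub> mon 2 x = \<zero>\<^bsub>G\<^esub>"
    by (auto simp: gr_part_eq)
  have x_carr: "x \<in> carrier R"
    by (rule pow_carrier[OF x(1)])
  have "mon 3 (a \<otimes> x) = \<zero>\<^bsub>G\<^esub>"
    using x(3) mon_mult[OF a x(1)] by (simp add: numeral_3_eq_3)
  then have "a \<otimes> x \<in> ipow 4"
    using mon_eq_zero_iff[of "a \<otimes> x" 3] carr x_carr by simp
  then have "x \<in> annihilator R a"
    using pow4 x_carr by (simp add: annihilator_def)
  then obtain r where r: "r \<in> carrier R" "x = b \<otimes> r"
    unfolding ann cgenideal_def using m_comm[OF carr(2)] by auto
  have "mon 1 b \<otimes>\<^bsub>G\<^esub> mon 0 r = \<zero>\<^bsub>G\<^esub>"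
    using mon_mult[OF b(1), of r 0] mon_eq_zero_iff[OF x_carr, of 1] x(1) r
    by (simp add: numeral_2_eq_2)
  moreover have "mon 1 b \<noteq> \<zero>\<^bsub>G\<^esub>"
    using mon_eq_zero_iff[OF carr(2), of 1] b(2) by (simp add: numeral_2_eq_2)
  ultimately have "mon 0 r = \<zero>\<^bsub>G\<^esub>"
    using gr.dim_mult_image_0(2)[OF mon_in_part[OF b(1)]] mon_in_part[of r 0] r(1) by auto
  then have r1: "r \<in> ipow 1"
    using mon_eq_zero_iff[OF r(1), of 0] by simp
  then have "f = mon 1 b \<otimes>\<^bsub>G\<^esub> mon 1 r"
    using mon_mult[OF b(1) r1] r(2) x(2) by (simp add: numeral_2_eq_2)
  with mon_in_part[OF r1] show "f \<in> (\<otimes>\<^bsub>G\<^esub>) (mon 1 b) ` gr_part R m 1"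
    by blast
qed

theorem exact_zd_pair_initial_forms:
  assumes pow4: "ipow 4 = {\<zero>}"
    and p: "fps_of_poly p = hilbert_series R m" "poly p (-1) = 0"
    and a: "a \<in> ipow 1" "a \<notin> ipow 2" and b: "b \<in> ipow 1" "b \<notin> ipow 2"
    and pair: "exact_zd_pair R a b"
  shows "exact_zd_pair G (mon 1 a) (mon 1 b)"
proof (rule gr.exact_zd_pair_if_short)
  have ann: "annihilator R a = PIdl b" "annihilator R b = PIdl a"
    using pair by (simp_all add: exact_zd_pair_def)
  note carr = pow_carrier[OF a(1)] pow_carrier[OF b(1)]
  show "mon 1 a \<in> gr_part R m 1" "mon 1 b \<in> gr_part R m 1"
    using a(1) b(1) by (simp_all only: mon_in_part)
  show "mon 1 a \<noteq> \<zero>\<^bsub>G\<^esub>" "mon 1 b \<noteq> \<zero>\<^bsub>G\<^esub>"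
    using a(2) b(2) carr by (simp_all add: mon_eq_zero_iff numeral_2_eq_2)
  show "mon 1 a \<otimes>\<^bsub>G\<^esub> mon 1 b = \<zero>\<^bsub>G\<^esub>"
    using mon_mult[OF a(1) b(1)] annihilator_eq_PIdlD[OF ann(1) carr(2)]
      mon_eq_zero_iff[OF zero_closed] by simp
  show "gr_part R m n = {\<zero>\<^bsub>G\<^esub>}" if "n \<ge> 4" for n
  proof -
    have "ipow n = {\<zero>}"
      using pow_antimono[OF that] pow4 pow_zero[of n] by blast
    then show ?thesis
      using mon_eq_zero_iff[OF zero_closed] by (simp add: gr_part_eq)
  qed
  show "fps_of_poly p = graded_hilbert_series G (gr_part R m)" "poly p (-1) = 0"
    using p by (simp_all add: hilbert_series_eq_graded_hilbert_series)
  show "{f \<in> gr_part R m 2. mon 1 a \<otimes>\<^bsub>G\<^esub> f = \<zero>\<^bsub>G\<^esub>} \<subseteq> (\<otimes>\<^bsub>G\<^esub>) (mon 1 b) ` gr_part R m 1"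
    by (rule kernel_mult_gr_part_2[OF pow4 a(1) b ann(1)])
  show "{f \<in> gr_part R m 2. mon 1 b \<otimes>\<^bsub>G\<^esub> f = \<zero>\<^bsub>G\<^esub>} \<subseteq> (\<otimes>\<^bsub>G\<^esub>) (mon 1 a) ` gr_part R m 1"
    by (rule kernel_mult_gr_part_2[OF pow4 b(1) a ann(2)])
qed

end

lemma local_noetherian_imp_noetherian_maximal:
  assumes "local_noetherian R m"
  shows "noetherian_maximal m R"
  using assms maximalideal.axioms(1)
  by (auto simp: local_noetherian_def noetherian_maximal_def cring_ideal_def)

theorem theorem2p5:
  fixes R :: "('a, 'b) ring_scheme" and m :: "'a set" and a b :: 'a
  assumes loc: "local_noetherian R m"
    and m4: "ideal_pow R m 4 = {\<zero>\<^bsub>R\<^esub>}"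
    and H: "\<exists>p. fps_of_poly p = hilbert_series R m \<and> poly p (-1) = 0"
    and a: "a \<in> m - ideal_pow R m 2" and b: "b \<in> m - ideal_pow R m 2"
    and ab: "exact_zd_pair R a b"
  shows "exact_zd_pair (gr R m) (initial_form R m a) (initial_form R m b)
    \<and> (let Ra = R Quot (PIdl\<^bsub>R\<^esub> a); ma = (\<lambda>x. PIdl\<^bsub>R\<^esub> a +>\<^bsub>R\<^esub> x) ` m;
           G = gr R m; A = PIdl\<^bsub>G\<^esub> (initial_form R m a); Q = G Quot A;
           DQ = (\<lambda>n. (\<lambda>f. A +>\<^bsub>G\<^esub> f) ` gr_part R m n) in
        (\<exists>h. h \<in> ring_iso Q (gr Ra ma)
             \<and> (\<forall>f \<in> carrier G. h (A +>\<^bsub>G\<^esub> f) = gr_map R m Ra ma (\<lambda>x. PIdl\<^bsub>R\<^esub> a +>\<^bsub>R\<^esub> x) f)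
             \<and> (\<forall>n. h ` DQ n = gr_part Ra ma n))
        \<and> graded_hilbert_series Q DQ = hilbert_series Ra ma
        \<and> hilbert_series Ra ma = hilbert_series R m * inverse (1 + fps_X))"
proof -
  interpret noetherian_maximal m R
    by (rule local_noetherian_imp_noetherian_maximal[OF loc])
  have a_pow: "a \<in> ipow 1" "a \<notin> ipow 2" and b_pow: "b \<in> ipow 1" "b \<notin> ipow 2"
    using a b unfolding pow_one by blast+
  have initial: "initial_form R m a = mon 1 a" "initial_form R m b = mon 1 b"
    using a_pow b_pow by (simp_all add: initial_form_eq numeral_2_eq_2)
  have pair: "exact_zd_pair G (mon 1 a) (mon 1 b)"
    using H exact_zd_pair_initial_forms[OF m4 _ _ a_pow b_pow ab] by blast
  note \<alpha> = mon_in_part[OF a_pow(1)] and \<beta> = mon_in_part[OF b_pow(1)]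
  interpret quot: cring_ideal_surjection m R "(+>\<^bsub>R\<^esub>) (PIdl\<^bsub>R\<^esub> a) ` m"
    "R Quot (PIdl\<^bsub>R\<^esub> a)" "(+>\<^bsub>R\<^esub>) (PIdl\<^bsub>R\<^esub> a)"
    by (rule cring_ideal_surjection_quotient_PIdl[OF pow_carrier[OF a_pow(1)]])
  have "a \<otimes>\<^bsub>R\<^esub> b = \<zero>\<^bsub>R\<^esub>" "annihilator G (mon 1 a) = PIdl\<^bsub>G\<^esub> (mon 1 b)"
    using ab pair annihilator_eq_PIdlD[of a b] by (simp_all add: exact_zd_pair_def)
  then have kernel: "quot.gr_kernel = PIdl\<^bsub>G\<^esub> (mon 1 a)"
    using a_kernel_quotient_PIdl[OF pow_carrier[OF a_pow(1)]] a_pow(1) b_pow(1)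
    by (intro quot.gr_map_kernel_eq_PIdl)
  note hilbert_Ra = gr.graded_hilbert_series_exact_pair_quotient[OF pair \<alpha> \<beta>
      quot.gmap.is_ring_hom_ring kernel, unfolded quot.gr_map_part]
  note hilbert_Q = gr.graded_hilbert_series_Quot_PIdl[OF pair \<alpha> \<beta>]
  show ?thesis
    unfolding Let_def initial using pair quot.gr_quotient_iso[unfolded kernel] hilbert_Q hilbert_Ra
      hilbert_series_eq_graded_hilbert_series quot.target.hilbert_series_eq_graded_hilbert_series
    by simp
qed

end
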